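(* Let $c>0$ and $0<\alpha<1$ be constants, and for each number of users $n$ let $m=m(n)=\lfloor c\,n^{2-\alpha}\rfloor$ be the number of observations per user. Let $p_1\in(0,1)$ be fixed, and let $p_2,p_3,\dots$ be drawn independently from a continuous density $f_P$ on $(0,1)$ for which there exist constants $\delta_2>\delta_1>0$ with $\delta_1<f_P(p)<\delta_2$ for $p\in(0,1)$ and $f_P(p)=0$ for $p\notin(0,1)$. Suppose the vector $P=(p_1,\dots,p_n)$ is known to the adversary. Let $X_u(t)$ and $\mathbf{Y}^{(m)}$ be the two-state user locations and the anonymized observations defined in the context. Then user $1$ has perfect location privacy at every time, i.e. $$\forall k\in\mathbb{N},\qquad \lim_{n\to\infty} I\big(X_1(k);\mathbf{Y}^{(m)}\,\big|\,P\big)=0 .$$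
   Context: Two-state i.i.d. model. There are users $u=1,2,3,\dots$ and two locations $0$ and $1$. $X_u(t)\in\{0,1\}$ is the location of user $u$ at time $t\in\mathbb{N}=\{1,2,\dots\}$. Conditionally on $(p_u)_{u\ge1}$, all the variables $X_u(t)$ ($u\ge1,\ t\ge1$) are mutually independent and $X_u(t)\sim \mathrm{Bernoulli}(p_u)$ (i.e. $p_u$ is the probability of being at location $1$). Anonymization. For each $n$, $\Pi=\Pi^{(n)}$ is a uniformly random permutation of $\{1,\dots,n\}$, independent of the $p_u$'s and of all $X_u(t)$. Put $\mathbf{X}_u^{(m)}=(X_u(1),\dots,X_u(m))^T$. The adversary observes the $m\times n$ matrix $$\mathbf{Y}^{(m)}=\big(\mathbf{X}^{(m)}_{\Pi^{-1}(1)},\mathbf{X}^{(m)}_{\Pi^{-1}(2)},\dots,\mathbf{X}^{(m)}_{\Pi^{-1}(n)}\big),$$ so that the $\Pi(u)$-th column of $\mathbf{Y}^{(m)}$ is $\mathbf{X}_u^{(m)}$. $I(X;Y\mid P)=H(X\mid P)-H(X\mid Y,P)$ is conditional mutual information (averaged over $P$); conditioning on $P=(p_1,\dots,p_n)$ expresses that the adversary knows $P$. *)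

theory Defs
  imports "HOL-Probability.Probability" "HOL-Combinatorics.Permutations"
begin

text \<open>
  The conditional probability of an event given a sub-\<open>\<sigma>\<close>-algebra \<open>F\<close>, as a random variable
  determined up to null sets.
\<close>

definition cprob :: "'a measure \<Rightarrow> 'a measure \<Rightarrow> ('a \<Rightarrow> bool) \<Rightarrow> 'a \<Rightarrow> real" where
  "cprob M F Q = real_cond_exp M F (indicator {\<omega> \<in> space M. Q \<omega>})"

definition cond_indep_vars ::
  "'a measure \<Rightarrow> 'a measure \<Rightarrow> ('i \<Rightarrow> 'b measure) \<Rightarrow> ('i \<Rightarrow> 'a \<Rightarrow> 'b) \<Rightarrow> 'i set \<Rightarrow> bool" where
  "cond_indep_vars M F N X I \<longleftrightarrow>
     (\<forall>i\<in>I. X i \<in> M \<rightarrow>\<^sub>M N i) \<and>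
     (\<forall>J\<subseteq>I. finite J \<longrightarrow> (\<forall>A. (\<forall>j\<in>J. A j \<in> sets (N j)) \<longrightarrow>
        (AE \<omega> in M. cprob M F (\<lambda>\<omega>. \<forall>j\<in>J. X j \<omega> \<in> A j) \<omega> =
                    (\<Prod>j\<in>J. cprob M F (\<lambda>\<omega>. X j \<omega> \<in> A j) \<omega>))))"

text \<open>
  Users and times are indexed from 1; the values at index 0 are irrelevant. \<open>Perm n\<close> is the
  random permutation used when there are \<open>n\<close> users; no joint law is imposed on
  the permutations for different \<open>n\<close>.
\<close>

locale anonymized_two_state_model = prob_space M
  for M :: "'a measure" +
  fixes p :: "nat \<Rightarrow> 'a \<Rightarrow> real"
    and X :: "nat \<Rightarrow> nat \<Rightarrow> 'a \<Rightarrow> nat"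
    and Perm :: "nat \<Rightarrow> 'a \<Rightarrow> (nat \<Rightarrow> nat)"
    and p1 :: real
    and f :: "real \<Rightarrow> real"
  assumes p_first: "\<And>\<omega>. \<omega> \<in> space M \<Longrightarrow> p 1 \<omega> = p1"
    and p_density: "\<And>u. u \<ge> 2 \<Longrightarrow> distributed M lborel (p u) (\<lambda>x. ennreal (f x))"
    and p_indep: "indep_vars (\<lambda>_. borel) p {2..}"
    and X_cond_indep:
      "cond_indep_vars M
         (vimage_algebra (space M) (\<lambda>\<omega>. \<lambda>u\<in>{1..}. p u \<omega>) (Pi\<^sub>M {1..} (\<lambda>_. borel)))
         (\<lambda>_. count_space {0, 1}) (\<lambda>(u, t). X u t) ({1..} \<times> {1..})"
    and X_cond_Bernoulli:
      "\<And>u t. u \<ge> 1 \<Longrightarrow> t \<ge> 1 \<Longrightarrow>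
         AE \<omega> in M. cprob M
           (vimage_algebra (space M) (\<lambda>\<omega>. \<lambda>u\<in>{1..}. p u \<omega>) (Pi\<^sub>M {1..} (\<lambda>_. borel)))
           (\<lambda>\<omega>. X u t \<omega> = 1) \<omega> = p u \<omega>"
    and Perm_measurable: "\<And>n. Perm n \<in> M \<rightarrow>\<^sub>M count_space {\<pi>. \<pi> permutes {1..n}}"
    and Perm_uniform:
      "\<And>n. distr M (count_space {\<pi>. \<pi> permutes {1..n}}) (Perm n) =
            uniform_count_measure {\<pi>. \<pi> permutes {1..n}}"
    and Perm_indep:
      "\<And>n. indep_set
         (sets (vimage_algebra (space M) (Perm n) (count_space {\<pi>. \<pi> permutes {1..n}})))
         (sets (vimage_algebra (space M)
           (\<lambda>\<omega>. (\<lambda>u\<in>{1..}. p u \<omega>, \<lambda>(u, t)\<in>{1..} \<times> {1..}. X u t \<omega>))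
           (Pi\<^sub>M {1..} (\<lambda>_. borel) \<Otimes>\<^sub>M Pi\<^sub>M ({1..} \<times> {1..}) (\<lambda>_. count_space {0, 1}))))"

text \<open>
  The \<open>m \<times> n\<close> matrix seen by the adversary, indexed by (time, column).
\<close>

definition observation ::
  "(nat \<Rightarrow> nat \<Rightarrow> 'a \<Rightarrow> nat) \<Rightarrow> (nat \<Rightarrow> 'a \<Rightarrow> (nat \<Rightarrow> nat)) \<Rightarrow> nat \<Rightarrow> nat \<Rightarrow> 'a \<Rightarrow> (nat \<times> nat \<Rightarrow> nat)" where
  "observation X Perm m n \<omega> = (\<lambda>(t, j)\<in>{1..m} \<times> {1..n}. X (inv (Perm n \<omega>) j) t \<omega>)"

definition observation_space :: "nat \<Rightarrow> nat \<Rightarrow> (nat \<times> nat \<Rightarrow> nat) measure" where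
  "observation_space m n = Pi\<^sub>M ({1..m} \<times> {1..n}) (\<lambda>_. count_space {0, 1})"

lemma (in anonymized_two_state_model) X_measurable:
  assumes "u \<ge> 1" "t \<ge> 1"
  shows "X u t \<in> M \<rightarrow>\<^sub>M count_space {0, 1}"
  using X_cond_indep assms unfolding cond_indep_vars_def by force

lemma (in anonymized_two_state_model) p_measurable:
  assumes "u \<ge> 1"
  shows "p u \<in> borel_measurable M"
proof (cases "u = 1")
  case True
  have "p 1 \<in> borel_measurable M \<longleftrightarrow> (\<lambda>_. p1) \<in> borel_measurable M"
    using p_first by (intro measurable_cong) auto
  then show ?thesis using True by simp
next
  case False
  then show ?thesis using p_density[of u] assms distributed_measurable[of M lborel "p u"] by auto
qed

lemma (in anonymized_two_state_model) observation_measurable: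
  "observation X Perm m n \<in> M \<rightarrow>\<^sub>M observation_space m n"
  unfolding observation_def observation_space_def
proof (rule measurable_restrict, clarsimp)
  fix t j assume tj: "Suc 0 \<le> t" "t \<le> m" "Suc 0 \<le> j" "j \<le> n"
  let ?S = "{\<pi>. \<pi> permutes {1..n}}"
  have inS: "inv \<pi> j \<in> {1..n}" if "\<pi> \<in> ?S" for \<pi>
    using that tj permutes_in_image[OF permutes_inv[of \<pi> "{1..n}"], of j] by auto
  show "(\<lambda>\<omega>. X (inv (Perm n \<omega>) j) t \<omega>) \<in> M \<rightarrow>\<^sub>M count_space {0, Suc 0}"
  proof (rule measurable_compose_countable'[where I = "?S" and f = "\<lambda>\<pi>. X (inv \<pi> j) t"])
    show "countable ?S" by (intro countable_finite finite_permutations) simp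
  next
    fix \<pi> assume "\<pi> \<in> ?S"
    then show "X (inv \<pi> j) t \<in> M \<rightarrow>\<^sub>M count_space {0, Suc 0}"
      using X_measurable[of "inv \<pi> j" t] inS[of \<pi>] tj by auto
  qed (rule Perm_measurable)
qed

text \<open>
  For a finite-valued \<open>X\<close>, the library's conditional mutual information, which is defined as
  \<open>I(X; (Y, Z)) - I(X; Z)\<close>, is \<open>H(X | Z) - H(X | Y, Z)\<close>. The conditional entropies here are
  taken with the law of the conditioning variable as reference measure, so that
  no density of that variable is needed.
\<close>

lemma (in information_space) mutual_information_eq_entropy_conditional_entropy_finite:
  assumes A: "finite A"
    and X[measurable]: "X \<in> M \<rightarrow>\<^sub>M count_space A"
    and Z[measurable]: "Z \<in> M \<rightarrow>\<^sub>M T"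
  shows "mutual_information b (count_space A) T X Z =
    entropy b (count_space A) X - conditional_entropy b (count_space A) (distr M T Z) X Z"
proof -
  define Q where "Q = distr M T Z"
  define C where "C = (count_space A :: 'b measure)"
  have setsQ[measurable_cong]: "sets Q = sets T" by (simp add: Q_def)
  interpret Q: prob_space Q unfolding Q_def by (rule prob_space_distr) simp
  interpret C: finite_measure C unfolding C_def using A by (rule finite_measure_count_space)
  interpret CQ: pair_sigma_finite C Q ..
  have XC[measurable]: "X \<in> M \<rightarrow>\<^sub>M C" by (simp add: C_def)
  have ZQ[measurable]: "Z \<in> M \<rightarrow>\<^sub>M Q" by (simp add: measurable_cong_sets[OF refl setsQ])
  have finCQ: "finite_measure (C \<Otimes>\<^sub>M Q)"
    by (rule finite_measure_pair_measure) unfold_locales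
  interpret CQf: finite_measure "C \<Otimes>\<^sub>M Q" by (rule finCQ)
  define J where "J = distr M (C \<Otimes>\<^sub>M Q) (\<lambda>x. (X x, Z x))"
  interpret J: prob_space J unfolding J_def by (rule prob_space_distr) simp
  have setsJ[measurable_cong]: "sets J = sets (C \<Otimes>\<^sub>M Q)" by (simp add: J_def)
  have J_le: "emeasure J N \<le> emeasure (C \<Otimes>\<^sub>M Q) N" if N[measurable]: "N \<in> sets (C \<Otimes>\<^sub>M Q)" for N
  proof -
    have Nx: "Pair x -` N \<in> sets Q" for x by (rule sets_Pair1[OF N])
    have "emeasure J N = emeasure M ((\<lambda>x. (X x, Z x)) -` N \<inter> space M)"
      unfolding J_def by (rule emeasure_distr) simp_all
    also have "\<dots> \<le> emeasure M (\<Union>x\<in>A. Z -` (Pair x -` N) \<inter> space M)"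
    proof (rule emeasure_mono)
      show "(\<lambda>x. (X x, Z x)) -` N \<inter> space M \<subseteq> (\<Union>x\<in>A. Z -` (Pair x -` N) \<inter> space M)"
        using measurable_space[OF X] by auto
      show "(\<Union>x\<in>A. Z -` (Pair x -` N) \<inter> space M) \<in> events"
        using measurable_sets[OF ZQ Nx] A by (intro sets.finite_UN) auto
    qed
    also have "\<dots> \<le> (\<Sum>x\<in>A. emeasure M (Z -` (Pair x -` N) \<inter> space M))"
      using measurable_sets[OF ZQ Nx] A by (intro emeasure_subadditive_finite) auto
    also have "\<dots> = (\<Sum>x\<in>A. emeasure Q (Pair x -` N))"
      using Nx setsQ unfolding Q_def by (intro sum.cong refl emeasure_distr[symmetric]) auto
    also have "\<dots> = emeasure (C \<Otimes>\<^sub>M Q) N"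
      by (subst Q.emeasure_pair_measure_alt[OF N])
        (simp add: C_def nn_integral_count_space_finite A)
    finally show ?thesis .
  qed
  have ac: "absolutely_continuous (C \<Otimes>\<^sub>M Q) J"
    unfolding absolutely_continuous_def
  proof
    fix N assume "N \<in> null_sets (C \<Otimes>\<^sub>M Q)"
    then show "N \<in> null_sets J"
      using J_le[of N] by (auto simp: null_sets_def setsJ)
  qed
  define R where "R = RN_deriv (C \<Otimes>\<^sub>M Q) J"
  have R[measurable]: "R \<in> borel_measurable (C \<Otimes>\<^sub>M Q)" unfolding R_def by simp
  have dR: "density (C \<Otimes>\<^sub>M Q) R = J"
    unfolding R_def by (rule CQ.density_RN_deriv[OF ac setsJ])
  have R1: "AE z in C \<Otimes>\<^sub>M Q. R z \<le> 1"
  proof -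
    define E where "E = {z \<in> space (C \<Otimes>\<^sub>M Q). R z > 1}"
    have E[measurable]: "E \<in> sets (C \<Otimes>\<^sub>M Q)" unfolding E_def by simp
    have "(\<integral>\<^sup>+z. R z * indicator E z \<partial>(C \<Otimes>\<^sub>M Q)) = emeasure J E"
      using dR E by (metis emeasure_density R)
    also have "\<dots> \<le> emeasure (C \<Otimes>\<^sub>M Q) E" by (rule J_le[OF E])
    finally have le: "(\<integral>\<^sup>+z. R z * indicator E z \<partial>(C \<Otimes>\<^sub>M Q)) \<le> (\<integral>\<^sup>+z. indicator E z \<partial>(C \<Otimes>\<^sub>M Q))"
      by simp
    have "(\<integral>\<^sup>+z. (R z * indicator E z - indicator E z) \<partial>(C \<Otimes>\<^sub>M Q)) =
       (\<integral>\<^sup>+z. R z * indicator E z \<partial>(C \<Otimes>\<^sub>M Q)) - (\<integral>\<^sup>+z. indicator E z \<partial>(C \<Otimes>\<^sub>M Q))"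
    proof (rule nn_integral_diff)
      show "(\<integral>\<^sup>+z. indicator E z \<partial>(C \<Otimes>\<^sub>M Q)) \<noteq> \<infinity>"
        using CQf.emeasure_finite[of E] by simp
      show "AE z in C \<Otimes>\<^sub>M Q. indicator E z \<le> R z * indicator E z"
        by (intro AE_I2) (auto simp: E_def indicator_def)
    qed simp_all
    also have "\<dots> = 0" using le le_less_trans[OF le]
      by (simp add: diff_eq_0_iff_ennreal CQf.emeasure_eq_measure)
    finally have "AE z in C \<Otimes>\<^sub>M Q. R z * indicator E z - indicator E z = 0"
      by (subst (asm) nn_integral_0_iff_AE) auto
    then show ?thesis
    proof (rule AE_mp, intro AE_I2 impI)
      fix z assume z: "z \<in> space (C \<Otimes>\<^sub>M Q)" and 0: "R z * indicator E z - indicator E z = 0"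
      show "R z \<le> 1"
      proof (rule ccontr)
        assume "\<not> R z \<le> 1"
        then have "R z - 1 = 0" "1 < R z" using z 0 by (auto simp: E_def not_le)
        then show False by (auto simp: diff_eq_0_iff_ennreal dest: leD)
      qed
    qed
  qed
  define Pxy where "Pxy = (\<lambda>z. enn2real (R z))"
  have Pxy[measurable]: "Pxy \<in> borel_measurable (C \<Otimes>\<^sub>M Q)" unfolding Pxy_def by simp
  have Pxy1: "AE z in C \<Otimes>\<^sub>M Q. 0 \<le> Pxy z \<and> Pxy z \<le> 1"
    using R1 by eventually_elim (simp add: Pxy_def enn2real_leI)
  have RP: "AE z in C \<Otimes>\<^sub>M Q. ennreal (Pxy z) = R z"
    using R1
  proof eventually_elim
    case (elim z)
    then have "R z < top" by (rule le_less_trans) simp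
    then show ?case by (simp add: Pxy_def)
  qed
  have dJ: "distributed M (C \<Otimes>\<^sub>M Q) (\<lambda>x. (X x, Z x)) Pxy"
    unfolding distributed_def
  proof (intro conjI)
    have "density (C \<Otimes>\<^sub>M Q) Pxy = density (C \<Otimes>\<^sub>M Q) R"
      using RP by (intro density_cong) auto
    then show "distr M (C \<Otimes>\<^sub>M Q) (\<lambda>x. (X x, Z x)) = density (C \<Otimes>\<^sub>M Q) Pxy"
      using dR by (simp add: J_def)
  qed simp_all
  define Px where "Px = (\<lambda>x. prob (X -` {x} \<inter> space M))"
  have dX: "distributed M C X Px"
    unfolding distributed_def
  proof (intro conjI)
    show "distr M C X = density C Px"
    proof (rule measure_eqI_finite[where A = A])
      fix a assume "a \<in> A"
      then show "emeasure (distr M C X) {a} = emeasure (density C Px) {a}"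
        using A by (simp add: emeasure_distr C_def emeasure_density nn_integral_count_space_finite
          Px_def emeasure_eq_measure indicator_def if_distrib[where f = "(*) _"] cong: if_cong)
    qed (use A in \<open>simp_all add: C_def\<close>)
  qed (simp_all add: C_def)
  have dZ: "distributed M Q Z (\<lambda>_. ennreal 1)"
    unfolding distributed_def
  proof (intro conjI)
    have "distr M Q Z = Q" unfolding Q_def by (rule distr_cong) simp_all
    then show "distr M Q Z = density Q (\<lambda>_. ennreal 1)" by (simp add: density_1)
  qed simp_all
  have lnb: "ln b > 0" using b_gt_1 by simp
  have "mutual_information b C Q X Z = entropy b C X - conditional_entropy b C Q X Z"
  proof (rule mutual_information_eq_entropy_conditional_entropy'[OF _ _ dX _ dZ _ dJ])
    show "sigma_finite_measure C" "sigma_finite_measure Q" by unfold_locales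
    show "0 \<le> Px x" for x by (simp add: Px_def)
    show "0 \<le> (1::real)" by simp
    show "0 \<le> Pxy x" for x by (simp add: Pxy_def)
    show "integrable (C \<Otimes>\<^sub>M Q) (\<lambda>x. Pxy x * log b 1)" by simp
    have Pxm[measurable]: "Px \<in> borel_measurable C" by (simp add: C_def)
    show "integrable (C \<Otimes>\<^sub>M Q) (\<lambda>x. Pxy x * log b (Px (fst x)))"
    proof (rule CQf.integrable_const_bound[where B = "\<Sum>a\<in>A. \<bar>log b (Px a)\<bar>"])
      show "AE x in C \<Otimes>\<^sub>M Q. norm (Pxy x * log b (Px (fst x))) \<le> (\<Sum>a\<in>A. \<bar>log b (Px a)\<bar>)"
        using Pxy1 AE_space
      proof eventually_elim
        case (elim x)
        then have "fst x \<in> A" by (auto simp: space_pair_measure C_def)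
        then have "\<bar>log b (Px (fst x))\<bar> \<le> (\<Sum>a\<in>A. \<bar>log b (Px a)\<bar>)"
          using A by (intro member_le_sum[of _ _ "\<lambda>a. \<bar>log b (Px a)\<bar>"]) auto
        moreover have "\<bar>Pxy x\<bar> * \<bar>log b (Px (fst x))\<bar> \<le> 1 * \<bar>log b (Px (fst x))\<bar>"
          using elim by (intro mult_right_mono) auto
        ultimately show ?case by (simp add: abs_mult)
      qed
    qed measurable
    show "integrable (C \<Otimes>\<^sub>M Q) (\<lambda>x. Pxy x * log b (Pxy x))"
    proof (rule CQf.integrable_const_bound[where B = "1 / ln b"])
      show "AE x in C \<Otimes>\<^sub>M Q. norm (Pxy x * log b (Pxy x)) \<le> 1 / ln b"
        using Pxy1
      proof eventually_elim
        case (elim x)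
        define t where "t = Pxy x"
        have t: "0 \<le> t" "t \<le> 1" using elim by (auto simp: t_def)
        have "\<bar>t * ln t\<bar> \<le> 1"
        proof (cases "t = 0")
          case False
          with t have "ln (1 / t) \<le> 1 / t - 1" by (intro ln_le_minus_one) simp
          then have "t * (- ln t) \<le> t * (1 / t - 1)"
            using t False by (intro mult_left_mono) (auto simp: ln_div)
          also have "\<dots> \<le> 1" using t False by (simp add: right_diff_distrib)
          finally have "- (t * ln t) \<le> 1" by simp
          moreover have "t * ln t \<le> 0" using t False by (simp add: mult_le_0_iff)
          ultimately show ?thesis by linarith
        qed simp
        then have "\<bar>t * ln t\<bar> / ln b \<le> 1 / ln b" using lnb by (intro divide_right_mono) auto
        then show ?case using lnb by (simp add: log_def t_def abs_mult)
      qed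
    qed measurable
  qed
  moreover have "mutual_information b C Q X Z = mutual_information b C T X Z"
  proof -
    have "distr M Q Z = distr M T Z" by (rule distr_cong) (simp_all add: setsQ)
    moreover have "distr M (C \<Otimes>\<^sub>M Q) (\<lambda>x. (X x, Z x)) = distr M (C \<Otimes>\<^sub>M T) (\<lambda>x. (X x, Z x))"
      by (intro distr_cong sets_pair_measure_cong) (simp_all add: setsQ)
    ultimately show ?thesis by (simp add: mutual_information_def)
  qed
  ultimately show ?thesis by (simp add: C_def Q_def)
qed

lemma (in information_space) conditional_mutual_information_eq_conditional_entropy_finite:
  assumes A: "finite A"
    and X[measurable]: "X \<in> M \<rightarrow>\<^sub>M count_space A"
    and Y[measurable]: "Y \<in> M \<rightarrow>\<^sub>M S"
    and Z[measurable]: "Z \<in> M \<rightarrow>\<^sub>M T"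
  shows "conditional_mutual_information b (count_space A) S T X Y Z =
    conditional_entropy b (count_space A) (distr M T Z) X Z -
    conditional_entropy b (count_space A) (distr M (S \<Otimes>\<^sub>M T) (\<lambda>\<omega>. (Y \<omega>, Z \<omega>))) X (\<lambda>\<omega>. (Y \<omega>, Z \<omega>))"
  unfolding conditional_mutual_information_def
  using mutual_information_eq_entropy_conditional_entropy_finite[OF A X Z]
    mutual_information_eq_entropy_conditional_entropy_finite[OF A X, of "\<lambda>\<omega>. (Y \<omega>, Z \<omega>)" "S \<Otimes>\<^sub>M T"]
  by simp

end

theory Submission
  imports Defs
begin

text \<open>
  Since \<open>X\<^sub>1(k)\<close> is independent of \<open>P\<close>, the conditional mutual information is the mutual
  information of \<open>X\<^sub>1(k)\<close> and \<open>(Y, P)\<close>, which is bounded by the \<open>\<chi>\<^sup>2\<close>-distance of the joint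
  law from the product law and hence by a multiple of
  \<open>\<eta> = sup\<^sub>A |E[(X\<^sub>1(k) - p\<^sub>1) 1\<^sub>A(Y, P)]|\<close>.

  Exchanging users \<open>1\<close> and \<open>u\<close> in both the trajectories and the permutation leaves \<open>Y\<close>
  unchanged and changes the likelihood by little in \<open>L\<^sup>1\<close> if \<open>|p\<^sub>u - p\<^sub>1| \<le> \<epsilon>\<close> and
  \<open>m \<epsilon>\<^sup>2\<close> is small. So \<open>X\<^sub>1(k)\<close> may be replaced by the average of \<open>X\<^sub>u(k)\<close> over the users
  \<open>u\<close> with \<open>|p\<^sub>u - p\<^sub>1| \<le> \<epsilon>\<close>; by the law of large numbers this average is close to \<open>p\<^sub>1\<close>
  once there are many such users. For \<open>\<epsilon> = n\<^bsup>\<alpha>/4 - 1\<^esup>\<close> their expected number is of order at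
  least \<open>n\<^bsup>\<alpha>/4\<^esup>\<close>, while \<open>m \<epsilon>\<^sup>2 \<le> c n\<^bsup>-\<alpha>/2\<^esup>\<close>.
\<close>

section \<open>Mutual information with a binary variable\<close>

text \<open>The adversary knows \<open>P\<close>, so exchanging two users is not a symmetry of the
  model: trajectories and permutation are exchanged while \<open>P\<close> has to stay where it is.
  The price is the distance between two product laws whose parameters differ in two users. Measured
  through chi-square it depends on m \<epsilon>^2, whereas adding up the L1 distances of the single
  observations would cost m \<epsilon>; this is what lets m come close to the order n^2. The radius
  has to satisfy n \<epsilon> \<rightarrow> \<infinity> (many candidates) and m \<epsilon>^2
  \<rightarrow> 0 (candidates that cannot be told apart), that is 1/n << \<epsilon> << n^(\<alpha>/2
  - 1). The exponent \<alpha>/4 - 1 is the midpoint of this window. Posterior laws given (Y, P)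
  never appear: everything is tested on events of (Y, P). The sum over the close users is normalized
  by their expected number, not by their random number, so every error term is a plain
  expectation.\<close>

lemma (in prob_space) expectation_abs_le_sqrt:
  fixes Z :: "'a \<Rightarrow> real"
  assumes [measurable]: "Z \<in> borel_measurable M" and sq: "integrable M (\<lambda>\<omega>. (Z \<omega>)\<^sup>2)"
    and le: "expectation (\<lambda>\<omega>. (Z \<omega>)\<^sup>2) \<le> B"
  shows "expectation (\<lambda>\<omega>. \<bar>Z \<omega>\<bar>) \<le> sqrt B"
proof -
  have "integrable M Z"
    by (rule square_integrable_imp_integrable[OF _ sq]) simp
  then have "integrable M (\<lambda>\<omega>. \<bar>Z \<omega>\<bar>)" by simp
  then have "0 \<le> expectation (\<lambda>\<omega>. \<bar>Z \<omega>\<bar>\<^sup>2) - (expectation (\<lambda>\<omega>. \<bar>Z \<omega>\<bar>))\<^sup>2"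
    using sq by (subst variance_eq[symmetric]) (auto intro!: integral_nonneg_AE)
  then have "(expectation (\<lambda>\<omega>. \<bar>Z \<omega>\<bar>))\<^sup>2 \<le> B" using le by simp
  then show ?thesis by (rule real_le_rsqrt)
qed

text \<open>A one-sided bound on events suffices: with \<open>E\<close> the set where
  \<open>D\<close> exceeds 1, the absolute value \<open>\<bar>D - 1\<bar>\<close> is twice
  \<open>D - 1\<close> restricted to \<open>E\<close> minus \<open>D - 1\<close>, and the last term
  has mean zero.\<close>

lemma (in prob_space) integral_abs_diff_one_le:
  fixes D :: "'a \<Rightarrow> real"
  assumes D: "integrable M D" "expectation D = 1"
    and dev: "\<And>A. A \<in> sets M \<Longrightarrow> expectation (\<lambda>x. indicator A x * (D x - 1)) \<le> \<epsilon>"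
  shows "expectation (\<lambda>x. \<bar>D x - 1\<bar>) \<le> 2 * \<epsilon>"
proof -
  have Dm[measurable]: "D \<in> borel_measurable M" using D(1) by simp
  define E where "E = {x \<in> space M. 1 < D x}"
  have E[measurable]: "E \<in> sets M" unfolding E_def by simp
  have "integrable M (\<lambda>x. indicator E x * (D x - 1))"
    using integrable_mult_indicator[OF E, of "\<lambda>x. D x - 1"] D by simp
  note int = this
  have "expectation (\<lambda>x. \<bar>D x - 1\<bar>) = expectation (\<lambda>x. 2 * (indicator E x * (D x - 1)) - (D x - 1))"
    by (rule Bochner_Integration.integral_cong) (auto simp: E_def indicator_def)
  also have "\<dots> = 2 * expectation (\<lambda>x. indicator E x * (D x - 1)) - (expectation D - 1)"
    using int D by (simp add: prob_space)
  finally show ?thesis using dev[OF E] D by simp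
qed

text \<open>Each value of \<open>X\<close> has probability at least \<open>\<kappa>\<close>, so the
  joint law is at most \<open>1 / \<kappa>\<close> times the product law and has a density
  \<open>D\<close> bounded by \<open>1 / \<kappa>\<close>. Then \<open>ln D \<le> D - 1\<close>
  bounds the information by the mean of (D - 1)^2, and boundedness of \<open>D\<close> trades one
  factor \<open>\<bar>D - 1\<bar>\<close> for \<open>1 / \<kappa>\<close>, which makes the bound
  linear in \<open>\<eta>\<close>. The constant 4 is 2 for the two values of \<open>X\<close> times
  2 for passing from events to the L1 norm.\<close>

lemma (in information_space) mutual_information_binary_bounds:
  fixes X :: "'a \<Rightarrow> nat"
  assumes X[measurable]: "X \<in> M \<rightarrow>\<^sub>M count_space {0, 1}" and W[measurable]: "W \<in> M \<rightarrow>\<^sub>M T"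
    and \<kappa>: "0 < \<kappa>" "\<And>i. i \<in> {0, 1} \<Longrightarrow> \<kappa> \<le> \<P>(\<omega> in M. X \<omega> = i)"
    and dev: "\<And>A. A \<in> sets T \<Longrightarrow>
      \<bar>\<P>(\<omega> in M. X \<omega> = 1 \<and> W \<omega> \<in> A) - \<P>(\<omega> in M. X \<omega> = 1) * \<P>(\<omega> in M. W \<omega> \<in> A)\<bar> \<le> \<eta>"
  shows "0 \<le> mutual_information b (count_space {0, 1}) T X W"
    and "mutual_information b (count_space {0, 1}) T X W \<le> 4 * \<eta> / (\<kappa> * ln b)"
proof -
  define C where "C = (count_space {0, 1} :: nat measure)"
  have X'[measurable]: "X \<in> M \<rightarrow>\<^sub>M C" unfolding C_def by (rule X)
  have X01: "X \<omega> \<in> {0, 1}" if "\<omega> \<in> space M" for \<omega> using measurable_space[OF X that] by simp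
  define R where "R = distr M C X \<Otimes>\<^sub>M distr M T W"
  define J where "J = distr M (C \<Otimes>\<^sub>M T) (\<lambda>x. (X x, W x))"
  interpret PX: prob_space "distr M C X" by (rule prob_space_distr) simp
  interpret PW: prob_space "distr M T W" by (rule prob_space_distr) simp
  interpret PP: pair_prob_space "distr M C X" "distr M T W" ..
  interpret R: prob_space R unfolding R_def by (rule PP.prob_space_axioms)
  interpret J: prob_space J unfolding J_def by (rule prob_space_distr) simp
  have setsR[measurable_cong]: "sets R = sets (C \<Otimes>\<^sub>M T)"
    unfolding R_def by (intro sets_pair_measure_cong) simp_all
  have setsJ: "sets J = sets R" by (simp add: J_def setsR)
  \<comment> \<open>A measurable set \<open>N\<close> of the product consists of its two sections
    over 0 and 1. Both laws of \<open>N\<close> are therefore finite sums: \<open>w\<close> measures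
    the sections under the law of \<open>W\<close> alone, \<open>v\<close> jointly with the value of
    \<open>X\<close>.\<close>
  define a where "a = (\<lambda>i. \<P>(\<omega> in M. X \<omega> = i))"
  define w where "w = (\<lambda>(N::(nat \<times> _) set) i. \<P>(\<omega> in M. W \<omega> \<in> Pair i -` N))"
  define v where "v = (\<lambda>(N::(nat \<times> _) set) i. \<P>(\<omega> in M. X \<omega> = i \<and> W \<omega> \<in> Pair i -` N))"
  have sec[measurable]: "Pair i -` N \<in> sets T" if "N \<in> sets R" for N :: "(nat \<times> _) set" and i
    using sets_Pair1[of N C T i] that setsR by simp
  have evX[measurable]: "{\<omega> \<in> space M. X \<omega> = i} \<in> events" for i
  proof -
    have "(\<lambda>\<omega>. X \<omega> = i) \<in> M \<rightarrow>\<^sub>M count_space UNIV"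
      by (rule measurable_compose[OF X]) simp
    then show ?thesis by (simp add: pred_def)
  qed
  have evW[measurable]: "{\<omega> \<in> space M. W \<omega> \<in> Pair i -` N} \<in> events" if "N \<in> sets R" for N and i :: nat
    using measurable_sets[OF W sec[OF that, of i]] by (simp add: vimage_def Int_def conj_commute)
  have evV[measurable]: "{\<omega> \<in> space M. X \<omega> = i \<and> W \<omega> \<in> Pair j -` N} \<in> events" if "N \<in> sets R" for N i j
    using evX[of i] evW[OF that, of j] by (intro sets.sets_Collect_conj)
  have J_eq: "measure J N = v N 0 + v N 1" if N: "N \<in> sets R" for N
  proof -
    have "measure J N = prob ((\<lambda>x. (X x, W x)) -` N \<inter> space M)"
      unfolding J_def using N setsR by (intro measure_distr) auto
    also have "(\<lambda>x. (X x, W x)) -` N \<inter> space M =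
      {\<omega> \<in> space M. X \<omega> = 0 \<and> W \<omega> \<in> Pair 0 -` N} \<union> {\<omega> \<in> space M. X \<omega> = 1 \<and> W \<omega> \<in> Pair 1 -` N}"
    proof (rule set_eqI)
      fix \<omega>
      show "\<omega> \<in> (\<lambda>x. (X x, W x)) -` N \<inter> space M \<longleftrightarrow> \<omega> \<in> {\<omega> \<in> space M. X \<omega> = 0 \<and> W \<omega> \<in> Pair 0 -` N} \<union> {\<omega> \<in> space M. X \<omega> = 1 \<and> W \<omega> \<in> Pair 1 -` N}"
        using X01[of \<omega>] by (cases "\<omega> \<in> space M") auto
    qed
    also have "prob \<dots> = v N 0 + v N 1"
      unfolding v_def using N by (intro finite_measure_Union) (auto intro!: evV simp del: vimage_eq)
    finally show ?thesis .
  qed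
  have R_eq: "measure R N = a 0 * w N 0 + a 1 * w N 1" if N: "N \<in> sets R" for N
  proof -
    have N': "N \<in> sets (distr M C X \<Otimes>\<^sub>M distr M T W)" using N unfolding R_def .
    have "emeasure R N = (\<integral>\<^sup>+x. emeasure (distr M T W) (Pair x -` N) \<partial>distr M C X)"
      unfolding R_def by (rule PW.emeasure_pair_measure_alt[OF N'])
    also have "\<dots> = (\<integral>\<^sup>+x. ennreal (w N x) \<partial>distr M C X)"
    proof (rule nn_integral_cong)
      fix x
      have "emeasure (distr M T W) (Pair x -` N) = ennreal (measure (distr M T W) (Pair x -` N))"
        by (rule PW.emeasure_eq_measure)
      also have "measure (distr M T W) (Pair x -` N) = w N x"
        unfolding w_def using N by (subst measure_distr) (auto intro!: arg_cong[where f = prob])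
      finally show "emeasure (distr M T W) (Pair x -` N) = ennreal (w N x)" .
    qed
    also have "\<dots> = (\<integral>\<^sup>+\<omega>. ennreal (w N (X \<omega>)) \<partial>M)"
      by (rule nn_integral_distr[OF X']) (simp add: C_def)
    also have "\<dots> = (\<integral>\<^sup>+\<omega>. ennreal (w N 0) * indicator {\<omega> \<in> space M. X \<omega> = 0} \<omega> +
       ennreal (w N 1) * indicator {\<omega> \<in> space M. X \<omega> = 1} \<omega> \<partial>M)"
    proof (rule nn_integral_cong)
      fix \<omega> assume "\<omega> \<in> space M"
      then show "ennreal (w N (X \<omega>)) = ennreal (w N 0) * indicator {\<omega> \<in> space M. X \<omega> = 0} \<omega> +
       ennreal (w N 1) * indicator {\<omega> \<in> space M. X \<omega> = 1} \<omega>"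
        using X01[of \<omega>] by (auto simp: indicator_def)
    qed
    also have "\<dots> = ennreal (w N 0) * ennreal (a 0) + ennreal (w N 1) * ennreal (a 1)"
      by (subst nn_integral_add) (simp_all add: nn_integral_cmult_indicator emeasure_eq_measure a_def)
    also have "\<dots> = ennreal (a 0 * w N 0 + a 1 * w N 1)"
    proof -
      have "0 \<le> a i" "0 \<le> w N i" for i by (simp_all add: a_def w_def)
      then show ?thesis by (simp add: ennreal_mult mult.commute)
    qed
    finally show ?thesis
      by (subst (asm) R.emeasure_eq_measure) (simp add: a_def w_def del: ennreal_plus)
  qed
  have vw: "v N i \<le> w N i" if "N \<in> sets R" for N i
    unfolding v_def w_def using evW[OF that, of i] by (intro finite_measure_mono) auto
  have JR: "measure J N \<le> measure R N / \<kappa>" if N: "N \<in> sets R" for N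
  proof -
    have "v N i \<le> a i * w N i / \<kappa>" if "i \<in> {0, 1}" for i
    proof -
      have "\<kappa> * w N i \<le> a i * w N i"
        using \<kappa>(2)[OF that] unfolding a_def by (intro mult_right_mono) (auto simp: w_def)
      then have "w N i \<le> a i * w N i / \<kappa>" using \<kappa>(1) by (simp add: field_simps)
      then show ?thesis using vw[OF N, of i] by simp
    qed
    from this[of 0] this[of 1] show ?thesis by (simp add: J_eq[OF N] R_eq[OF N] add_divide_distrib)
  qed
  have a01: "a 0 + a 1 = 1"
  proof -
    have "a 0 + a 1 = prob ({\<omega> \<in> space M. X \<omega> = 0} \<union> {\<omega> \<in> space M. X \<omega> = 1})"
      unfolding a_def by (intro finite_measure_Union[symmetric]) auto
    also have "{\<omega> \<in> space M. X \<omega> = 0} \<union> {\<omega> \<in> space M. X \<omega> = 1} = space M" using X01 by auto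
    finally show ?thesis by (simp add: prob_space)
  qed
  have \<kappa>1: "\<kappa> \<le> 1 / 2" using \<kappa>(2)[of 0] \<kappa>(2)[of 1] a01 by (simp add: a_def)
  \<comment> \<open>The hypothesis \<open>dev\<close> only speaks about \<open>X = 1\<close>. On a
    fixed section the deviation for \<open>X = 0\<close> is the negative of the one for
    \<open>X = 1\<close>, so each of the two sections contributes at most
    \<open>\<eta>\<close>.\<close>
  have JR_dev: "measure J N - measure R N \<le> 2 * \<eta>" if N: "N \<in> sets R" for N
  proof -
    have 1: "v N 1 - a 1 * w N 1 \<le> \<eta>"
      using dev[OF sec[OF N, of 1]] unfolding a_def v_def w_def by simp
    have "v' + v N 0 = w N 0" if "v' = \<P>(\<omega> in M. X \<omega> = 1 \<and> W \<omega> \<in> Pair 0 -` N)" for v'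
    proof -
      have "v' + v N 0 = prob ({\<omega> \<in> space M. X \<omega> = 1 \<and> W \<omega> \<in> Pair 0 -` N} \<union>
          {\<omega> \<in> space M. X \<omega> = 0 \<and> W \<omega> \<in> Pair 0 -` N})"
        unfolding v_def that using N
        by (intro finite_measure_Union[symmetric]) (auto intro!: evV simp del: vimage_eq)
      also have "\<dots> = w N 0"
        unfolding w_def by (intro arg_cong[where f = prob]) (auto dest: X01)
      finally show ?thesis .
    qed
    moreover have "\<bar>\<P>(\<omega> in M. X \<omega> = 1 \<and> W \<omega> \<in> Pair 0 -` N) - a 1 * w N 0\<bar> \<le> \<eta>"
      using dev[OF sec[OF N, of 0]] unfolding a_def w_def by simp
    ultimately have "v N 0 - (1 - a 1) * w N 0 \<le> \<eta>" by (auto simp: algebra_simps)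
    then have "v N 0 - a 0 * w N 0 \<le> \<eta>" using a01 by (metis add_diff_cancel_right')
    with 1 show ?thesis by (simp add: J_eq[OF N] R_eq[OF N])
  qed
  have ac: "absolutely_continuous R J"
    unfolding absolutely_continuous_def
  proof
    fix N assume "N \<in> null_sets R"
    then show "N \<in> null_sets J"
      using JR[of N] by (auto simp: null_sets_def setsJ R.emeasure_eq_measure J.emeasure_eq_measure
        measure_le_0_iff)
  qed
  obtain D where D[measurable]: "D \<in> borel_measurable R" and RN: "AE x in R. RN_deriv R J x = ennreal (D x)"
    and D0: "\<And>x. 0 \<le> D x"
    using R.real_RN_deriv[OF J.finite_measure_axioms ac setsJ] by blast
  have dD: "density R (\<lambda>x. ennreal (D x)) = J"
    using R.density_RN_deriv[OF ac setsJ] RN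
    by (subst density_cong[of _ _ "RN_deriv R J"]) auto
  have D_int: "integrable R D" and D1: "R.expectation D = 1"
  proof -
    have "(\<integral>\<^sup>+x. ennreal (D x) \<partial>R) = emeasure J (space R)"
      unfolding dD[symmetric] by (subst emeasure_density) (auto intro!: nn_integral_cong)
    also have "\<dots> = 1" using J.emeasure_space_1 sets_eq_imp_space_eq[OF setsJ] by simp
    finally have 1: "(\<integral>\<^sup>+x. ennreal (D x) \<partial>R) = 1" .
    then show "integrable R D" using D0 by (intro integrableI_nonneg) auto
    show "R.expectation D = 1" using 1 D0 by (subst integral_eq_nn_integral) auto
  qed
  have D_set: "R.expectation (\<lambda>x. indicator N x * D x) = measure J N" if [measurable]: "N \<in> sets R" for N
  proof -
    have "measure J N = enn2real (emeasure (density R (\<lambda>x. ennreal (D x))) N)"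
      by (simp add: dD measure_def)
    also have "\<dots> = enn2real (\<integral>\<^sup>+x. ennreal (indicator N x * D x) \<partial>R)"
      by (subst emeasure_density) (auto intro!: arg_cong[where f = enn2real] nn_integral_cong split: split_indicator)
    also have "\<dots> = R.expectation (\<lambda>x. indicator N x * D x)"
      using D0 by (intro integral_eq_nn_integral[symmetric]) auto
    finally show ?thesis ..
  qed
  have ind_int: "integrable R (indicator N :: _ \<Rightarrow> real)" if "N \<in> sets R" for N
    using that by (intro integrable_real_indicator) (auto simp: R.emeasure_eq_measure)
  have D_int_set: "integrable R (\<lambda>x. indicator N x * D x)" if "N \<in> sets R" for N
    using integrable_mult_indicator[OF that D_int] by simp
  \<comment> \<open>On the set \<open>E\<close> where \<open>D\<close> exceeds
    \<open>1 / \<kappa>\<close>, the excess is positive but has integral at most zero by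
    \<open>JR\<close>, so \<open>E\<close> is a null set.\<close>
  have D_le: "AE x in R. D x \<le> 1 / \<kappa>"
  proof -
    define E where "E = {x \<in> space R. 1 / \<kappa> < D x}"
    have E[measurable]: "E \<in> sets R" unfolding E_def by simp
    have int: "integrable R (\<lambda>x. indicator E x * D x - indicator E x * (1 / \<kappa>))"
      using D_int_set[OF E] ind_int[OF E] by (intro Bochner_Integration.integrable_diff) auto
    have nonneg: "0 \<le> indicator E x * D x - indicator E x * (1 / \<kappa>)" for x
      by (auto simp: E_def indicator_def)
    have "R.expectation (\<lambda>x. indicator E x * D x - indicator E x * (1 / \<kappa>)) = measure J E - measure R E / \<kappa>"
      using D_int_set[OF E] ind_int[OF E] by (subst Bochner_Integration.integral_diff) (auto simp: D_set)
    also have "\<dots> \<le> 0" using JR[OF E] by simp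
    finally have "R.expectation (\<lambda>x. indicator E x * D x - indicator E x * (1 / \<kappa>)) = 0"
      using nonneg by (intro antisym integral_nonneg_AE) auto
    then have "AE x in R. indicator E x * D x - indicator E x * (1 / \<kappa>) = 0"
      using integral_nonneg_eq_0_iff_AE[OF int] nonneg by auto
    then show ?thesis using AE_space
      by eventually_elim (rule ccontr, auto simp: E_def indicator_def not_le)
  qed
  have lnb: "0 < ln b" using b_gt_1 by simp
  have MI: "mutual_information b (count_space {0, 1}) T X W = R.expectation (\<lambda>x. D x * log b (D x))"
    unfolding mutual_information_def C_def[symmetric] R_def[symmetric] J_def[symmetric] dD[symmetric]
    using b_gt_1 D0 by (intro R.KL_density) auto
  have Dlog_le: "D x * log b (D x) \<le> D x * (D x - 1) / ln b" for x
  proof (cases "D x = 0")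
    case False
    then have "0 < D x" using D0[of x] by simp
    then have "D x * ln (D x) \<le> D x * (D x - 1)"
      by (intro mult_left_mono ln_le_minus_one) auto
    then show ?thesis using lnb by (simp add: log_def divide_right_mono)
  qed simp
  have int_sq: "integrable R (\<lambda>x. D x * (D x - 1))"
  proof (rule R.integrable_const_bound[where B = "1 / \<kappa> * (1 / \<kappa> + 1)"])
    show "AE x in R. norm (D x * (D x - 1)) \<le> 1 / \<kappa> * (1 / \<kappa> + 1)"
      using D_le
    proof eventually_elim
      case (elim x)
      then show ?case unfolding norm_mult using D0[of x] \<kappa>(1)
        by (intro mult_mono) auto
    qed
  qed simp
  \<comment> \<open>The constant has to dominate both signs: from above through
    \<open>Dlog_le\<close> and the bound on \<open>D\<close>, from below through
    \<open>- t * ln t \<le> 1\<close>.\<close>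
  have int_log: "integrable R (\<lambda>x. D x * log b (D x))"
  proof (rule R.integrable_const_bound[where B = "(1 / \<kappa> * (1 / \<kappa> + 1) + 1) / ln b"])
    show "AE x in R. norm (D x * log b (D x)) \<le> (1 / \<kappa> * (1 / \<kappa> + 1) + 1) / ln b"
      using D_le
    proof eventually_elim
      case (elim x)
      have "D x * (D x - 1) \<le> 1 / \<kappa> * (1 / \<kappa> + 1)"
        using D0[of x] \<kappa>(1) elim by (intro order.trans[OF mult_left_mono[of "D x - 1" "D x"]] mult_mono) auto
      then have 1: "D x * (D x - 1) / ln b \<le> (1 / \<kappa> * (1 / \<kappa> + 1) + 1) / ln b"
        using lnb by (intro divide_right_mono) auto
      have "- (D x * ln (D x)) \<le> 1"
      proof (cases "D x = 0")
        case False
        then have pos: "0 < D x" using D0[of x] by simp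
        have "D x * ln (1 / D x) \<le> D x * (1 / D x - 1)"
          using pos by (intro mult_left_mono ln_le_minus_one) auto
        also have "\<dots> \<le> 1" using pos by (simp add: right_diff_distrib)
        finally show ?thesis using pos by (simp add: ln_div)
      qed simp
      also have "1 \<le> 1 / \<kappa> * (1 / \<kappa> + 1) + 1" using \<kappa>(1) by simp
      finally have "- (D x * ln (D x)) / ln b \<le> (1 / \<kappa> * (1 / \<kappa> + 1) + 1) / ln b"
        using lnb by (intro divide_right_mono) auto
      then show ?case using 1 Dlog_le[of x] by (auto simp: log_def abs_le_iff)
    qed
  qed simp
  show "0 \<le> mutual_information b (count_space {0, 1}) T X W"
  proof -
    interpret R': information_space R b by unfold_locales (rule b_gt_1)
    have "prob_space (density R (\<lambda>x. ennreal (D x)))" unfolding dD by (rule J.prob_space_axioms)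
    then have "0 \<le> KL_divergence b R (density R (\<lambda>x. ennreal (D x)))"
      using D0 int_log by (intro R'.KL_nonneg) auto
    then show ?thesis
      unfolding mutual_information_def C_def[symmetric] R_def[symmetric] J_def[symmetric] dD .
  qed
  have "R.expectation (\<lambda>x. \<bar>D x - 1\<bar>) \<le> 2 * (2 * \<eta>)"
  proof (rule R.integral_abs_diff_one_le[OF D_int D1])
    fix A assume A[measurable]: "A \<in> sets R"
    have "R.expectation (\<lambda>x. indicator A x * (D x - 1)) = measure J A - measure R A"
      using D_int_set[OF A] ind_int[OF A] by (simp add: right_diff_distrib D_set[OF A])
    then show "R.expectation (\<lambda>x. indicator A x * (D x - 1)) \<le> 2 * \<eta>" using JR_dev[OF A] by simp
  qed
  note L1 = this
  have "R.expectation (\<lambda>x. D x * log b (D x)) \<le> R.expectation (\<lambda>x. D x * (D x - 1) / ln b)"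
    using int_sq int_log by (intro integral_mono Dlog_le) auto
  also have "\<dots> = R.expectation (\<lambda>x. D x * (D x - 1)) / ln b" by simp
  \<comment> \<open>Subtracting \<open>D - 1\<close>, which has mean zero, completes the square: the
    integrand becomes (D - 1)^2.\<close>
  also have "R.expectation (\<lambda>x. D x * (D x - 1)) = R.expectation (\<lambda>x. D x * (D x - 1) - (D x - 1))"
    using int_sq D_int D1 by (simp add: R.prob_space)
  also have "\<dots> \<le> R.expectation (\<lambda>x. 1 / \<kappa> * \<bar>D x - 1\<bar>)"
  proof (rule integral_mono_AE)
    show "AE x in R. D x * (D x - 1) - (D x - 1) \<le> 1 / \<kappa> * \<bar>D x - 1\<bar>"
      using D_le
    proof eventually_elim
      case (elim x)
      have "1 \<le> 1 / \<kappa>" using \<kappa>(1) \<kappa>1 by simp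
      then have "\<bar>D x - 1\<bar> \<le> 1 / \<kappa>" using elim D0[of x] by (auto simp: abs_le_iff)
      then have "\<bar>D x - 1\<bar> * \<bar>D x - 1\<bar> \<le> 1 / \<kappa> * \<bar>D x - 1\<bar>" by (rule mult_right_mono) simp
      then show ?case by (simp add: algebra_simps)
    qed
  qed (use int_sq D_int in auto)
  also have "\<dots> = R.expectation (\<lambda>x. \<bar>D x - 1\<bar>) / \<kappa>" by simp
  finally have "R.expectation (\<lambda>x. D x * log b (D x)) \<le> R.expectation (\<lambda>x. \<bar>D x - 1\<bar>) / \<kappa> / ln b"
    using lnb by (simp add: divide_right_mono)
  also have "\<dots> \<le> 4 * \<eta> / \<kappa> / ln b"
    using L1 lnb \<kappa>(1) by (intro divide_right_mono) auto
  finally show "mutual_information b (count_space {0, 1}) T X W \<le> 4 * \<eta> / (\<kappa> * ln b)"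
    unfolding MI by simp
qed

section \<open>Exchanging two users\<close>

definition bern :: "real \<Rightarrow> nat \<Rightarrow> real" where
  "bern q i = (if i = 1 then q else 1 - q)"

text \<open>Trajectories are indexed by (user, time), observations by (time, column).\<close>

definition weight :: "nat \<Rightarrow> nat \<Rightarrow> (nat \<Rightarrow> real) \<Rightarrow> (nat \<times> nat \<Rightarrow> nat) \<Rightarrow> real" where
  "weight n m P x = (\<Prod>j\<in>{1..n} \<times> {1..m}. bern (P (fst j)) (x j))"

lemma sum_binary_prod:
  fixes F :: "'i \<Rightarrow> nat \<Rightarrow> real"
  assumes "finite I"
  shows "(\<Sum>x\<in>I \<rightarrow>\<^sub>E {0, 1}. \<Prod>i\<in>I. F i (x i)) = (\<Prod>i\<in>I. F i 0 + F i 1)"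
  using prod_sum_PiE[OF assms, of "\<lambda>_. {0, 1}" F] by simp

text \<open>The left side is the second moment of the likelihood ratio of
  Bernoulli(\<open>r\<close>) against Bernoulli(\<open>q\<close>), that is one plus their chi-square
  divergence. This quantity, unlike the L1 distance, is multiplicative over independent
  coordinates.\<close>

lemma bern_chi_square:
  assumes "0 < q" "q < 1"
  shows "(bern r 0)\<^sup>2 / bern q 0 + (bern r 1)\<^sup>2 / bern q 1 = 1 + (r - q)\<^sup>2 / (q * (1 - q))"
proof -
  have "q * (1 - q) \<noteq> 0" "1 - q \<noteq> 0" using assms by auto
  then have "(bern r 0)\<^sup>2 / bern q 0 + (bern r 1)\<^sup>2 / bern q 1 = ((1 - r)\<^sup>2 * q + r\<^sup>2 * (1 - q)) / (q * (1 - q))"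
    by (simp add: bern_def add_frac_eq mult.commute)
  also have "(1 - r)\<^sup>2 * q + r\<^sup>2 * (1 - q) = q * (1 - q) + (r - q)\<^sup>2"
    by (simp add: power2_eq_square algebra_simps)
  finally show ?thesis using assms by (simp add: add_divide_distrib)
qed

text \<open>Cauchy-Schwarz with weight \<open>w\<close> bounds the square of the L1 distance by the
  chi-square divergence of the two product laws, and one plus that divergence factors over the
  coordinates.\<close>

lemma bernoulli_product_l1_le:
  fixes P Q :: "'i \<Rightarrow> real"
  assumes I: "finite I" and P: "\<And>i. i \<in> I \<Longrightarrow> 0 < P i \<and> P i < 1"
  shows "(\<Sum>x\<in>I \<rightarrow>\<^sub>E {0, 1}. \<bar>(\<Prod>i\<in>I. bern (Q i) (x i)) - (\<Prod>i\<in>I. bern (P i) (x i))\<bar>)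
    \<le> sqrt ((\<Prod>i\<in>I. 1 + (Q i - P i)\<^sup>2 / (P i * (1 - P i))) - 1)"
proof (rule real_le_rsqrt)
  define w where "w = (\<lambda>x::'i \<Rightarrow> nat. \<Prod>i\<in>I. bern (P i) (x i))"
  define w' where "w' = (\<lambda>x::'i \<Rightarrow> nat. \<Prod>i\<in>I. bern (Q i) (x i))"
  have w: "0 < w x" for x unfolding w_def using P by (intro prod_pos) (auto simp: bern_def)
  have sum_w: "(\<Sum>x\<in>I \<rightarrow>\<^sub>E {0, 1}. w x) = 1" "(\<Sum>x\<in>I \<rightarrow>\<^sub>E {0, 1}. w' x) = 1"
    unfolding w_def w'_def by (simp_all add: sum_binary_prod[OF I, of "\<lambda>i. bern (_ i)"] del: One_nat_def) (simp_all add: bern_def)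
  have sum_sq: "(\<Sum>x\<in>I \<rightarrow>\<^sub>E {0, 1}. (w' x)\<^sup>2 / w x) = (\<Prod>i\<in>I. 1 + (Q i - P i)\<^sup>2 / (P i * (1 - P i)))"
  proof -
    have "(\<Sum>x\<in>I \<rightarrow>\<^sub>E {0, 1}. (w' x)\<^sup>2 / w x) =
       (\<Sum>x\<in>I \<rightarrow>\<^sub>E {0, 1}. \<Prod>i\<in>I. (bern (Q i) (x i))\<^sup>2 / bern (P i) (x i))"
      unfolding w_def w'_def by (simp add: prod_dividef prod_power_distrib)
    also have "\<dots> = (\<Prod>i\<in>I. (bern (Q i) 0)\<^sup>2 / bern (P i) 0 + (bern (Q i) 1)\<^sup>2 / bern (P i) 1)"
      by (rule sum_binary_prod[OF I])
    also have "\<dots> = (\<Prod>i\<in>I. 1 + (Q i - P i)\<^sup>2 / (P i * (1 - P i)))"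
      using P by (intro prod.cong refl bern_chi_square) auto
    finally show ?thesis .
  qed
  have "(\<Sum>x\<in>I \<rightarrow>\<^sub>E {0, 1}. \<bar>w' x - w x\<bar>) = (\<Sum>x\<in>I \<rightarrow>\<^sub>E {0, 1}. sqrt (w x) * (\<bar>w' x - w x\<bar> / sqrt (w x)))"
    using w by (intro sum.cong) (simp_all add: less_imp_neq[symmetric])
  then have "(\<Sum>x\<in>I \<rightarrow>\<^sub>E {0, 1}. \<bar>w' x - w x\<bar>)\<^sup>2 \<le>
      (\<Sum>x\<in>I \<rightarrow>\<^sub>E {0, 1}. (sqrt (w x))\<^sup>2) * (\<Sum>x\<in>I \<rightarrow>\<^sub>E {0, 1}. (\<bar>w' x - w x\<bar> / sqrt (w x))\<^sup>2)"
    using Cauchy_Schwarz_ineq_sum[of "\<lambda>x. sqrt (w x)" "\<lambda>x. \<bar>w' x - w x\<bar> / sqrt (w x)" "I \<rightarrow>\<^sub>E {0, 1}"] by simp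
  also have "(\<Sum>x\<in>I \<rightarrow>\<^sub>E {0, 1}. (sqrt (w x))\<^sup>2) = 1"
    using w sum_w by (simp add: less_imp_le)
  \<comment> \<open>After expanding the square, the last two terms sum to -2 and 1 because both
    weights have total mass 1; what is left is the second moment of the likelihood ratio minus
    1.\<close>
  also have "(\<Sum>x\<in>I \<rightarrow>\<^sub>E {0, 1}. (\<bar>w' x - w x\<bar> / sqrt (w x))\<^sup>2) = (\<Sum>x\<in>I \<rightarrow>\<^sub>E {0, 1}. (w' x)\<^sup>2 / w x - 2 * w' x + w x)"
  proof (rule sum.cong[OF refl])
    fix x
    have "(\<bar>w' x - w x\<bar> / sqrt (w x))\<^sup>2 = (w' x - w x)\<^sup>2 / w x"
      using w[of x] by (simp add: power_divide)
    also have "\<dots> = (w' x)\<^sup>2 / w x - 2 * w' x + w x"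
      using w[of x] by (simp add: field_simps power2_eq_square)
    finally show "(\<bar>w' x - w x\<bar> / sqrt (w x))\<^sup>2 = (w' x)\<^sup>2 / w x - 2 * w' x + w x" .
  qed
  also have "\<dots> = (\<Prod>i\<in>I. 1 + (Q i - P i)\<^sup>2 / (P i * (1 - P i))) - 1"
    by (simp add: sum.distrib sum_subtractf sum_w sum_sq del: One_nat_def flip: sum_distrib_left)
  finally show "(\<Sum>x\<in>I \<rightarrow>\<^sub>E {0, 1}. \<bar>(\<Prod>i\<in>I. bern (Q i) (x i)) - (\<Prod>i\<in>I. bern (P i) (x i))\<bar>)\<^sup>2
    \<le> (\<Prod>i\<in>I. 1 + (Q i - P i)\<^sup>2 / (P i * (1 - P i))) - 1"
    unfolding w_def w'_def by simp
qed

text \<open>Only the rows of users 1 and \<open>u\<close> change their parameter, so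
  \<open>2 * m\<close> factors of the product differ from 1, each at most
  \<open>1 + \<epsilon>\<^sup>2 / \<kappa>\<close>. The constant \<open>\<kappa>\<close> bounds the
  two Bernoulli variances in the denominators from below.\<close>

lemma weight_swap_l1_le:
  fixes P :: "nat \<Rightarrow> real"
  assumes P: "\<And>v. v \<in> {1..n} \<Longrightarrow> 0 < P v \<and> P v < 1"
    and u: "u \<in> {2..n}" and \<kappa>: "0 < \<kappa>" "\<kappa> \<le> P 1 * (1 - P 1)" "\<kappa> \<le> P u * (1 - P u)"
    and \<epsilon>: "\<bar>P u - P 1\<bar> \<le> \<epsilon>"
  shows "(\<Sum>x\<in>{1..n} \<times> {1..m} \<rightarrow>\<^sub>E {0, 1}. \<bar>weight n m (P \<circ> Transposition.transpose 1 u) x - weight n m P x\<bar>)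
    \<le> sqrt (exp (2 * real m * \<epsilon>\<^sup>2 / \<kappa>) - 1)"
proof -
  define Q where "Q = P \<circ> Transposition.transpose 1 u"
  define F where "F = (\<lambda>v. 1 + (Q v - P v)\<^sup>2 / (P v * (1 - P v)))"
  have F: "1 \<le> F v" if "v \<in> {1..n}" for v using P[OF that] unfolding F_def by simp
  have F_le: "F v \<le> exp (\<epsilon>\<^sup>2 / \<kappa>)" if "v = 1 \<or> v = u" for v
  proof -
    have "(Q v - P v)\<^sup>2 = (P u - P 1)\<^sup>2"
      using that by (auto simp: Q_def power2_commute)
    also have "\<dots> \<le> \<epsilon>\<^sup>2" using power_mono[OF \<epsilon>, of 2] by simp
    finally have "(Q v - P v)\<^sup>2 / (P v * (1 - P v)) \<le> \<epsilon>\<^sup>2 / \<kappa>"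
      using \<kappa> that by (intro frac_le) auto
    then have "F v \<le> 1 + \<epsilon>\<^sup>2 / \<kappa>" by (simp add: F_def)
    also have "\<dots> \<le> exp (\<epsilon>\<^sup>2 / \<kappa>)" by (rule exp_ge_add_one_self)
    finally show ?thesis .
  qed
  have F_1: "F v = 1" if "v \<noteq> 1" "v \<noteq> u" for v
    using that by (simp add: F_def Q_def)
  have "(\<Prod>j\<in>{1..n} \<times> {1..m}. F (fst j)) = (\<Prod>v\<in>{1..n}. F v ^ m)"
    using prod.cartesian_product[of "\<lambda>v t. F v" "{1..m}" "{1..n}"] by (simp add: case_prod_unfold)
  also have "\<dots> = (\<Prod>v\<in>{1, u}. F v ^ m)"
    using u F_1 by (intro prod.mono_neutral_right) auto
  also have "\<dots> = F 1 ^ m * F u ^ m" using u by simp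
  also have "\<dots> \<le> exp (\<epsilon>\<^sup>2 / \<kappa>) ^ m * exp (\<epsilon>\<^sup>2 / \<kappa>) ^ m"
    using F[of 1] F[of u] F_le[of 1] F_le[of u] u by (intro mult_mono power_mono) auto
  also have "\<dots> = exp (2 * real m * \<epsilon>\<^sup>2 / \<kappa>)"
    by (simp add: exp_of_nat_mult[symmetric] exp_add[symmetric])
  finally have "(\<Prod>j\<in>{1..n} \<times> {1..m}. F (fst j)) - 1 \<le> exp (2 * real m * \<epsilon>\<^sup>2 / \<kappa>) - 1" by simp
  moreover have "(\<Sum>x\<in>{1..n} \<times> {1..m} \<rightarrow>\<^sub>E {0, 1}. \<bar>weight n m Q x - weight n m P x\<bar>)
      \<le> sqrt ((\<Prod>j\<in>{1..n} \<times> {1..m}. F (fst j)) - 1)"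
    unfolding weight_def F_def using P by (intro bernoulli_product_l1_le) auto
  ultimately show ?thesis unfolding Q_def by (meson order_trans real_sqrt_le_mono)
qed

text \<open>Moves the exchange from the trajectories to the parameters, so that the effect of the
  exchange becomes a comparison of two product laws at the same \<open>x\<close>.\<close>

lemma weight_swap:
  assumes "u \<in> {1..n}"
  shows "weight n m P (\<lambda>(v, t). x (Transposition.transpose 1 u v, t)) = weight n m (P \<circ> Transposition.transpose 1 u) x"
  unfolding weight_def
proof (rule prod.reindex_bij_witness[where i = "\<lambda>(v, t). (Transposition.transpose 1 u v, t)" and j = "\<lambda>(v, t). (Transposition.transpose 1 u v, t)"])
qed (use assms in \<open>auto simp: Transposition.transpose_def split: if_splits\<close>)

lemma bij_betw_swap_rows:
  fixes n m u :: nat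
  assumes "u \<in> {1..n}"
  shows "bij_betw (\<lambda>x (v, t). x (Transposition.transpose 1 u v, t)) ({1..n} \<times> {1..m} \<rightarrow>\<^sub>E B) ({1..n} \<times> {1..m} \<rightarrow>\<^sub>E B)"
proof (rule bij_betwI[where g = "\<lambda>x (v, t). x (Transposition.transpose 1 u v, t)"])
  have "Transposition.transpose 1 u v \<in> {1..n} \<longleftrightarrow> v \<in> {1..n}" for v
    using assms by (auto simp: Transposition.transpose_def)
  then have "(\<lambda>(v, t). x (Transposition.transpose 1 u v, t)) \<in> {1..n} \<times> {1..m} \<rightarrow>\<^sub>E B"
    if "x \<in> {1..n} \<times> {1..m} \<rightarrow>\<^sub>E B" for x
    using that by (intro PiE_I) (auto simp del: atLeastAtMost_iff One_nat_def intro: PiE_mem PiE_arb)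
  then show "(\<lambda>x (v, t). x (Transposition.transpose 1 u v, t)) \<in> ({1..n} \<times> {1..m} \<rightarrow>\<^sub>E B) \<rightarrow> ({1..n} \<times> {1..m} \<rightarrow>\<^sub>E B)"
    by blast
  then show "(\<lambda>x (v, t). x (Transposition.transpose 1 u v, t)) \<in> ({1..n} \<times> {1..m} \<rightarrow>\<^sub>E B) \<rightarrow> ({1..n} \<times> {1..m} \<rightarrow>\<^sub>E B)" .
qed (auto simp: fun_eq_iff)

lemma bij_betw_permutes_compose:
  assumes "\<sigma> permutes S"
  shows "bij_betw (\<lambda>\<pi>. \<pi> \<circ> \<sigma>) {\<pi>. \<pi> permutes S} {\<pi>. \<pi> permutes S}"
proof (rule bij_betwI[where g = "\<lambda>\<pi>. \<pi> \<circ> inv \<sigma>"])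
qed (use assms in \<open>auto simp: permutes_compose permutes_inv permutes_inv_o comp_assoc\<close>)

section \<open>The joint law\<close>

text \<open>Bridges two forms of independence: the model states it for generated \<sigma>-algebras,
  whereas factoring an expectation uses random variables. A function of a variable generates a
  smaller \<sigma>-algebra than the variable itself.\<close>

lemma (in prob_space) indep_var_compose_indep_set:
  assumes ind: "indep_set (sets (vimage_algebra (space M) X S)) (sets (vimage_algebra (space M) Y T))"
    and X: "X \<in> M \<rightarrow>\<^sub>M S" and Y: "Y \<in> M \<rightarrow>\<^sub>M T"
    and f: "f \<in> S \<rightarrow>\<^sub>M U" and g: "g \<in> T \<rightarrow>\<^sub>M V"
  shows "indep_var U (f \<circ> X) V (g \<circ> Y)"
proof -
  have sub: "sigma_sets (space M) {(k \<circ> Z) -` A \<inter> space M |A. A \<in> sets R} \<subseteq> sets (vimage_algebra (space M) Z N)"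
    if Z: "Z \<in> M \<rightarrow>\<^sub>M N" and k: "k \<in> N \<rightarrow>\<^sub>M R" for Z :: "'a \<Rightarrow> 'x" and k :: "'x \<Rightarrow> 'y" and N R
  proof -
    have "(k \<circ> Z) -` A \<inter> space M \<in> sets (vimage_algebra (space M) Z N)" if A: "A \<in> sets R" for A
    proof -
      have "(k \<circ> Z) -` A \<inter> space M = Z -` (k -` A \<inter> space N) \<inter> space M"
        using measurable_space[OF Z] by auto
      then show ?thesis using in_vimage_algebra[OF measurable_sets[OF k A], of Z "space M"] by simp
    qed
    then show ?thesis
      using sets.sigma_sets_subset[of "{(k \<circ> Z) -` A \<inter> space M |A. A \<in> sets R}" "vimage_algebra (space M) Z N"]
      by auto
  qed
  show ?thesis
    unfolding indep_var_eq
  proof (intro conjI)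
    show "random_variable U (f \<circ> X)" "random_variable V (g \<circ> Y)"
      using measurable_comp[OF X f] measurable_comp[OF Y g] by simp_all
    show "indep_set (sigma_sets (space M) {(f \<circ> X) -` A \<inter> space M |A. A \<in> sets U})
        (sigma_sets (space M) {(g \<circ> Y) -` A \<inter> space M |A. A \<in> sets V})"
      unfolding indep_set_def
    proof (rule indep_sets_mono_sets[OF ind[unfolded indep_set_def]])
      fix i :: bool
      show "case_bool (sigma_sets (space M) {(f \<circ> X) -` A \<inter> space M |A. A \<in> sets U})
          (sigma_sets (space M) {(g \<circ> Y) -` A \<inter> space M |A. A \<in> sets V}) i
        \<subseteq> case_bool (sets (vimage_algebra (space M) X S)) (sets (vimage_algebra (space M) Y T)) i"
        using sub[OF X f] sub[OF Y g] by (cases i) (simp_all only: bool.case)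
    qed
  qed
qed

context anonymized_two_state_model
begin

abbreviation p_algebra :: "'a measure" where
  "p_algebra \<equiv> vimage_algebra (space M) (\<lambda>\<omega>. \<lambda>u\<in>{1..}. p u \<omega>) (Pi\<^sub>M {1..} (\<lambda>_. borel))"

definition p_upto :: "nat \<Rightarrow> 'a \<Rightarrow> nat \<Rightarrow> real" where
  "p_upto n \<omega> = (\<lambda>u\<in>{1..n}. p u \<omega>)"

definition X_upto :: "nat \<Rightarrow> nat \<Rightarrow> 'a \<Rightarrow> nat \<times> nat \<Rightarrow> nat" where
  "X_upto n m \<omega> = (\<lambda>(u, t)\<in>{1..n} \<times> {1..m}. X u t \<omega>)"

lemma X_values:
  assumes "u \<ge> 1" "t \<ge> 1" "\<omega> \<in> space M"
  shows "X u t \<omega> \<in> {0, 1}"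
  using measurable_space[OF X_measurable[OF assms(1,2)] assms(3)] by simp

lemma measurable_fun_X:
  assumes "u \<ge> 1" "t \<ge> 1"
  shows "(\<lambda>\<omega>. (g (X u t \<omega>) :: real)) \<in> borel_measurable M"
  by (rule measurable_compose[OF X_measurable[OF assms]]) simp

lemma events_X:
  assumes "u \<ge> 1" "t \<ge> 1"
  shows "{\<omega> \<in> space M. X u t \<omega> = i} \<in> events"
proof -
  have "(\<lambda>\<omega>. X u t \<omega> = i) \<in> M \<rightarrow>\<^sub>M count_space UNIV"
    by (rule measurable_compose[OF X_measurable[OF assms]]) simp
  then show ?thesis by (simp add: pred_def)
qed

lemma p_sequence_measurable: "(\<lambda>\<omega>. \<lambda>u\<in>{1..}. p u \<omega>) \<in> M \<rightarrow>\<^sub>M Pi\<^sub>M {1..} (\<lambda>_. borel)"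
  by (rule measurable_restrict) (use p_measurable in auto)

lemma p_sequence_measurable_p_algebra:
  "(\<lambda>\<omega>. \<lambda>u\<in>{1..}. p u \<omega>) \<in> p_algebra \<rightarrow>\<^sub>M Pi\<^sub>M {1..} (\<lambda>_. borel)"
  by (rule measurable_vimage_algebra1) (auto simp: space_PiM)

lemma subalgebra_p: "subalgebra M p_algebra"
  unfolding subalgebra_def
proof
  show "sets p_algebra \<subseteq> sets M"
    unfolding sets_vimage_algebra
    by (rule sets.sigma_sets_subset) (use p_sequence_measurable in \<open>auto intro: measurable_sets\<close>)
qed simp

sublocale p_alg: finite_measure_subalgebra M p_algebra
  by unfold_locales (rule subalgebra_p)

lemma p_measurable_p_algebra:
  assumes "u \<ge> 1"
  shows "p u \<in> borel_measurable p_algebra"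
proof -
  have "(\<lambda>\<omega>. (\<lambda>u\<in>{1..}. p u \<omega>) u) \<in> borel_measurable p_algebra"
    using assms by (intro measurable_compose[OF p_sequence_measurable_p_algebra] measurable_component_singleton) simp
  then show ?thesis using assms by simp
qed

text \<open>The model conditions on the whole sequence of parameters, the adversary knows the first
  \<open>n\<close> of them. Measurability for the larger \<sigma>-algebra makes functions of the
  finite vector admissible as factors \<open>h\<close> in
  \<open>expectation_pattern\<close>.\<close>

lemma p_upto_measurable_p_algebra: "p_upto n \<in> p_algebra \<rightarrow>\<^sub>M Pi\<^sub>M {1..n} (\<lambda>_. borel)"
  unfolding p_upto_def[abs_def]
  by (rule measurable_restrict) (use p_measurable_p_algebra in auto)

lemma p_upto_measurable: "p_upto n \<in> M \<rightarrow>\<^sub>M Pi\<^sub>M {1..n} (\<lambda>_. borel)"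
  by (rule measurable_from_subalg[OF subalgebra_p p_upto_measurable_p_algebra])

lemma AE_cprob_X:
  assumes "u \<ge> 1" "t \<ge> 1" "i \<in> {0, 1}"
  shows "AE \<omega> in M. cprob M p_algebra (\<lambda>\<omega>. X u t \<omega> = i) \<omega> = bern (p u \<omega>) i"
proof (cases "i = 1")
  case True
  then show ?thesis using X_cond_Bernoulli[OF assms(1,2)] by (simp add: bern_def)
next
  case False
  then have i: "i = 0" using assms by simp
  note ev[measurable] = events_X[OF assms(1,2)]
  have "AE \<omega> in M. real_cond_exp M p_algebra (\<lambda>\<omega>. 1 - indicator {\<omega> \<in> space M. X u t \<omega> = 1} \<omega>) \<omega> =
     real_cond_exp M p_algebra (\<lambda>_. 1) \<omega> - real_cond_exp M p_algebra (indicator {\<omega> \<in> space M. X u t \<omega> = 1}) \<omega>"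
    by (rule p_alg.real_cond_exp_diff) (auto intro!: integrable_real_indicator simp: emeasure_eq_measure)
  moreover have "AE \<omega> in M. real_cond_exp M p_algebra (\<lambda>_. 1) \<omega> = 1"
    by (rule p_alg.real_cond_exp_F_meas) auto
  moreover have "AE \<omega> in M. real_cond_exp M p_algebra (indicator {\<omega> \<in> space M. X u t \<omega> = 0}) \<omega> =
      real_cond_exp M p_algebra (\<lambda>\<omega>. 1 - indicator {\<omega> \<in> space M. X u t \<omega> = 1} \<omega>) \<omega>"
  proof (rule p_alg.real_cond_exp_cong)
    show "AE \<omega> in M. indicator {\<omega> \<in> space M. X u t \<omega> = 0} \<omega> = (1 - indicator {\<omega> \<in> space M. X u t \<omega> = 1} \<omega> :: real)"
    proof (rule AE_I2)
      fix \<omega> assume "\<omega> \<in> space M"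
      then show "indicator {\<omega> \<in> space M. X u t \<omega> = 0} \<omega> = (1 - indicator {\<omega> \<in> space M. X u t \<omega> = 1} \<omega> :: real)"
        using X_values[OF assms(1,2), of \<omega>] by (auto simp: indicator_def)
    qed
  qed auto
  ultimately show ?thesis using X_cond_Bernoulli[OF assms(1,2)]
    unfolding cprob_def i by eventually_elim (simp add: bern_def)
qed

text \<open>Integrated form of the hypotheses on \<open>X\<close>: conditional independence and the
  Bernoulli laws hold almost everywhere for each finite pattern, and integrating them against a
  bounded factor \<open>h\<close> known from the parameters removes the conditional expectations.
  Later arguments rely on this form only.\<close>

lemma expectation_pattern:
  assumes J: "finite J" "J \<subseteq> {1..} \<times> {1..}" and x: "\<And>j. j \<in> J \<Longrightarrow> x j \<in> {0, 1}"
    and h: "h \<in> borel_measurable p_algebra" and bounded: "\<And>\<omega>. \<omega> \<in> space M \<Longrightarrow> \<bar>h \<omega>\<bar> \<le> B"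
  shows "integrable M (\<lambda>\<omega>. h \<omega> * (\<Prod>j\<in>J. bern (p (fst j) \<omega>) (x j)))"
    and "expectation (\<lambda>\<omega>. h \<omega> * indicator {\<omega> \<in> space M. \<forall>j\<in>J. X (fst j) (snd j) \<omega> = x j} \<omega>) =
      expectation (\<lambda>\<omega>. h \<omega> * (\<Prod>j\<in>J. bern (p (fst j) \<omega>) (x j)))"
proof -
  define E where "E = {\<omega> \<in> space M. \<forall>j\<in>J. X (fst j) (snd j) \<omega> = x j}"
  have E[measurable]: "E \<in> events"
    unfolding E_def using J by (intro sets.sets_Collect_finite_All events_X) auto
  note h[measurable]
  have h'[measurable]: "h \<in> borel_measurable M" by (rule measurable_from_subalg[OF subalgebra_p h])
  have int: "integrable M (\<lambda>\<omega>. h \<omega> * indicator E \<omega>)"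
    by (rule integrable_const_bound[where B = "\<bar>B\<bar>"])
      (auto intro!: AE_I2 split: split_indicator dest!: bounded)
  have "AE \<omega> in M. cprob M p_algebra (\<lambda>\<omega>. \<forall>j\<in>J. (case j of (u, t) \<Rightarrow> X u t) \<omega> \<in> {x j}) \<omega> =
       (\<Prod>j\<in>J. cprob M p_algebra (\<lambda>\<omega>. (case j of (u, t) \<Rightarrow> X u t) \<omega> \<in> {x j}) \<omega>)"
    using X_cond_indep[unfolded cond_indep_vars_def, THEN conjunct2, rule_format, OF J(2,1), of "\<lambda>j. {x j}"] x
    by (simp del: One_nat_def)
  then have 1: "AE \<omega> in M. real_cond_exp M p_algebra (indicator E) \<omega> =
       (\<Prod>j\<in>J. cprob M p_algebra (\<lambda>\<omega>. X (fst j) (snd j) \<omega> = x j) \<omega>)"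
    by (simp add: cprob_def E_def case_prod_unfold)
  have "AE \<omega> in M. \<forall>j\<in>J. cprob M p_algebra (\<lambda>\<omega>. X (fst j) (snd j) \<omega> = x j) \<omega> = bern (p (fst j) \<omega>) (x j)"
  proof (rule AE_finite_allI[OF J(1)])
    fix j assume "j \<in> J"
    then show "AE \<omega> in M. cprob M p_algebra (\<lambda>\<omega>. X (fst j) (snd j) \<omega> = x j) \<omega> = bern (p (fst j) \<omega>) (x j)"
      using J x by (intro AE_cprob_X) auto
  qed
  with 1 have 2: "AE \<omega> in M. h \<omega> * real_cond_exp M p_algebra (indicator E) \<omega> =
      h \<omega> * (\<Prod>j\<in>J. bern (p (fst j) \<omega>) (x j))"
    by eventually_elim simp
  have pm[measurable]: "(\<lambda>\<omega>. bern (p (fst j) \<omega>) (x j)) \<in> borel_measurable M" if "j \<in> J" for j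
  proof -
    have [measurable]: "p (fst j) \<in> borel_measurable M" using that J by (intro p_measurable) auto
    show ?thesis by (cases "x j = 1") (simp_all add: bern_def)
  qed
  have m1: "(\<lambda>\<omega>. h \<omega> * (\<Prod>j\<in>J. bern (p (fst j) \<omega>) (x j))) \<in> borel_measurable M"
    by (intro borel_measurable_times h' borel_measurable_prod pm)
  note rc = p_alg.real_cond_exp_intg[OF int h borel_measurable_indicator[OF E]]
  \<comment> \<open>The parameters are not yet known to lie in the unit interval, so the
    \<open>bern\<close> factors come without a pointwise bound; integrability is inherited from the
    conditional expectation, which agrees with them almost everywhere.\<close>
  show "integrable M (\<lambda>\<omega>. h \<omega> * (\<Prod>j\<in>J. bern (p (fst j) \<omega>) (x j)))"
    using rc(1) m1 2 by (subst integrable_cong_AE[symmetric, OF _ _ 2]) auto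
  show "expectation (\<lambda>\<omega>. h \<omega> * indicator {\<omega> \<in> space M. \<forall>j\<in>J. X (fst j) (snd j) \<omega> = x j} \<omega>) =
      expectation (\<lambda>\<omega>. h \<omega> * (\<Prod>j\<in>J. bern (p (fst j) \<omega>) (x j)))"
    unfolding E_def[symmetric] rc(2)[symmetric]
    using rc(1) m1 by (intro integral_cong_AE 2) auto
qed

text \<open>The permutation is independent of parameters and trajectories together, so its indicator
  splits off as the factor one over the number of permutations, and
  \<open>expectation_pattern\<close> evaluates the rest.\<close>

lemma expectation_pattern_Perm:
  assumes \<pi>: "\<pi> permutes {1..n}" and x: "x \<in> {1..n} \<times> {1..m} \<rightarrow>\<^sub>E {0, 1}"
    and g: "g \<in> borel_measurable (Pi\<^sub>M {1..n} (\<lambda>_. borel))" and bounded: "\<And>P. \<bar>g P\<bar> \<le> B"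
  shows "expectation (\<lambda>\<omega>. g (p_upto n \<omega>) * indicator {\<omega> \<in> space M. X_upto n m \<omega> = x \<and> Perm n \<omega> = \<pi>} \<omega>) =
      expectation (\<lambda>\<omega>. g (p_upto n \<omega>) * weight n m (p_upto n \<omega>) x) / card {\<pi>. \<pi> permutes {1..n}}"
proof -
  define S where "S = {\<pi>. \<pi> permutes {1..n}}"
  define J where "J = {1..n} \<times> {1..m}"
  let ?T = "Pi\<^sub>M {1..} (\<lambda>_. borel) \<Otimes>\<^sub>M Pi\<^sub>M ({1..} \<times> {1..}) (\<lambda>_. count_space {0, 1}) :: ((nat \<Rightarrow> real) \<times> (nat \<times> nat \<Rightarrow> nat)) measure"
  let ?Z = "\<lambda>\<omega>. (\<lambda>u\<in>{1..}. p u \<omega>, \<lambda>(u, t)\<in>{1..} \<times> {1..}. X u t \<omega>)"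
  have Z: "?Z \<in> M \<rightarrow>\<^sub>M ?T"
    by (intro measurable_Pair p_sequence_measurable measurable_restrict) (auto intro!: X_measurable simp del: One_nat_def)
  \<comment> \<open>Independence is stated for the infinite families of all parameters and all
    locations, so the integrand is written as a function of these. A product of coordinate
    indicators reduces measurability of the pattern event to single coordinates.\<close>
  define G where "G = (\<lambda>z::(nat \<Rightarrow> real) \<times> (nat \<times> nat \<Rightarrow> nat).
    g (restrict (fst z) {1..n}) * (\<Prod>j\<in>J. indicator {x j} (snd z j)))"
  have G: "G \<in> borel_measurable ?T"
    unfolding G_def
  proof (intro borel_measurable_times borel_measurable_prod)
    show "(\<lambda>z. g (restrict (fst z) {1..n})) \<in> borel_measurable ?T"
      by (rule measurable_compose[OF _ g], rule measurable_compose[OF measurable_fst], rule measurable_restrict_subset) auto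
    show "(\<lambda>z. indicator {x j} (snd z j) :: real) \<in> borel_measurable ?T" if "j \<in> J" for j
    proof -
      have "(\<lambda>z. snd z j) \<in> ?T \<rightarrow>\<^sub>M count_space {0, 1}"
        using that by (intro measurable_compose[OF measurable_snd] measurable_component_singleton) (auto simp: J_def)
      then show ?thesis by (rule measurable_compose) simp
    qed
  qed
  have ind2: "indep_var borel ((indicator {\<pi>} :: _ \<Rightarrow> real) \<circ> Perm n) borel (G \<circ> ?Z)"
    by (rule indep_var_compose_indep_set[OF Perm_indep Perm_measurable Z _ G]) simp
  have event: "(\<Prod>j\<in>J. indicator {x j} (snd (?Z \<omega>) j)) =
      (indicator {\<omega> \<in> space M. \<forall>j\<in>J. X (fst j) (snd j) \<omega> = x j} \<omega> :: real)" if "\<omega> \<in> space M" for \<omega>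
  proof -
    have "(\<Prod>j\<in>J. indicator {x j} (snd (?Z \<omega>) j)) = (\<Prod>j\<in>J. if X (fst j) (snd j) \<omega> = x j then 1 else (0::real))"
      by (intro prod.cong) (auto simp: J_def)
    also have "\<dots> = (if \<forall>j\<in>J. X (fst j) (snd j) \<omega> = x j then 1 else 0)"
      by (auto simp: J_def intro!: prod_zero prod.neutral)
    finally show ?thesis using that by (simp add: indicator_def)
  qed
  have restr: "restrict (fst (?Z \<omega>)) {1..n} = p_upto n \<omega>" for \<omega>
    by (auto simp: p_upto_def fun_eq_iff restrict_def)
  have GZ: "(G \<circ> ?Z) \<omega> = g (p_upto n \<omega>) * indicator {\<omega> \<in> space M. \<forall>j\<in>J. X (fst j) (snd j) \<omega> = x j} \<omega>"
    if "\<omega> \<in> space M" for \<omega>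
    unfolding comp_def G_def restr event[OF that] ..
  have GZm: "G \<circ> ?Z \<in> borel_measurable M" by (rule measurable_comp[OF Z G])
  have int1: "integrable M (G \<circ> ?Z)"
  proof (rule integrable_const_bound[where B = "\<bar>B\<bar>", OF _ GZm], rule AE_I2)
    fix \<omega> assume "\<omega> \<in> space M"
    then show "norm ((G \<circ> ?Z) \<omega>) \<le> \<bar>B\<bar>"
      unfolding GZ[OF \<open>\<omega> \<in> space M\<close>] using bounded[of "p_upto n \<omega>"] by (auto split: split_indicator)
  qed
  have Pm: "(indicator {\<pi>} :: _ \<Rightarrow> real) \<circ> Perm n \<in> borel_measurable M"
    by (rule measurable_comp[OF Perm_measurable]) simp
  have int2: "integrable M ((indicator {\<pi>} :: _ \<Rightarrow> real) \<circ> Perm n)"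
    by (rule integrable_const_bound[where B = 1]) (use Pm in \<open>auto split: split_indicator\<close>)
  have "finite S" unfolding S_def by (rule finite_permutations) simp
  have "expectation (\<lambda>\<omega>. g (p_upto n \<omega>) * indicator {\<omega> \<in> space M. X_upto n m \<omega> = x \<and> Perm n \<omega> = \<pi>} \<omega>) =
    expectation (\<lambda>\<omega>. ((indicator {\<pi>} :: _ \<Rightarrow> real) \<circ> Perm n) \<omega> * (G \<circ> ?Z) \<omega>)"
  proof (rule Bochner_Integration.integral_cong[OF refl])
    fix \<omega> assume \<omega>: "\<omega> \<in> space M"
    have "X_upto n m \<omega> = x \<longleftrightarrow> (\<forall>j\<in>J. X (fst j) (snd j) \<omega> = x j)"
      using x by (auto simp: X_upto_def J_def fun_eq_iff PiE_def extensional_def)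
    then show "g (p_upto n \<omega>) * indicator {\<omega> \<in> space M. X_upto n m \<omega> = x \<and> Perm n \<omega> = \<pi>} \<omega> =
        ((indicator {\<pi>} :: _ \<Rightarrow> real) \<circ> Perm n) \<omega> * (G \<circ> ?Z) \<omega>"
      unfolding GZ[OF \<omega>] using \<omega> by (auto simp: indicator_def)
  qed
  also have "\<dots> = expectation ((indicator {\<pi>} :: _ \<Rightarrow> real) \<circ> Perm n) * expectation (G \<circ> ?Z)"
    by (rule indep_var_lebesgue_integral[OF ind2 int2 int1])
  also have "expectation ((indicator {\<pi>} :: _ \<Rightarrow> real) \<circ> Perm n) = 1 / card S"
  proof -
    have "expectation ((indicator {\<pi>} :: _ \<Rightarrow> real) \<circ> Perm n) =
        (\<integral>\<rho>. indicator {\<pi>} \<rho> \<partial>distr M (count_space S) (Perm n))"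
      unfolding comp_def using Perm_measurable[of n]
      by (intro integral_distr[symmetric]) (auto simp: S_def)
    also have "\<dots> = (\<integral>\<rho>. indicator {\<pi>} \<rho> \<partial>uniform_count_measure S)"
      using Perm_uniform[of n] by (simp add: S_def)
    also have "\<dots> = measure (uniform_count_measure S) {\<pi>}"
      using \<pi> by (simp add: S_def space_uniform_count_measure)
    also have "\<dots> = 1 / card S"
      using \<pi> \<open>finite S\<close> by (subst measure_uniform_count_measure) (auto simp: S_def)
    finally show ?thesis .
  qed
  also have "expectation (G \<circ> ?Z) = expectation (\<lambda>\<omega>. g (p_upto n \<omega>) * weight n m (p_upto n \<omega>) x)"
  proof -
    have "expectation (G \<circ> ?Z) = expectation (\<lambda>\<omega>. g (p_upto n \<omega>) * indicator {\<omega> \<in> space M. \<forall>j\<in>J. X (fst j) (snd j) \<omega> = x j} \<omega>)"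
      by (rule Bochner_Integration.integral_cong[OF refl GZ])
    also have "\<dots> = expectation (\<lambda>\<omega>. g (p_upto n \<omega>) * (\<Prod>j\<in>J. bern (p (fst j) \<omega>) (x j)))"
      by (rule expectation_pattern(2)[where B = B])
        (use x bounded measurable_compose[OF p_upto_measurable_p_algebra g] in \<open>auto simp: J_def simp del: One_nat_def\<close>)
    also have "\<dots> = expectation (\<lambda>\<omega>. g (p_upto n \<omega>) * weight n m (p_upto n \<omega>) x)"
      unfolding weight_def J_def
      by (intro Bochner_Integration.integral_cong refl arg_cong2[where f = "(*)"] prod.cong)
        (auto simp: p_upto_def)
    finally show ?thesis .
  qed
  finally show ?thesis by (simp add: S_def)
qed

end

text \<open>Orthogonality kills the mixed terms, so second moments add. They are bounded by
  \<open>q\<close> and not merely by 1: with \<open>q\<close> the probability of being close to user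
  1, the sum is then of the order of the square root of the expected number of close users, small
  compared with that number itself.\<close>

lemma (in prob_space) expectation_abs_sum_orthogonal_le:
  fixes Z :: "'i \<Rightarrow> 'a \<Rightarrow> real" and q :: real
  assumes I: "finite I" and Z[measurable]: "\<And>i. i \<in> I \<Longrightarrow> Z i \<in> borel_measurable M"
    and bounded: "\<And>i \<omega>. i \<in> I \<Longrightarrow> \<omega> \<in> space M \<Longrightarrow> \<bar>Z i \<omega>\<bar> \<le> 1"
    and orth: "\<And>i j. i \<in> I \<Longrightarrow> j \<in> I \<Longrightarrow> i \<noteq> j \<Longrightarrow> expectation (\<lambda>\<omega>. Z i \<omega> * Z j \<omega>) = 0"
    and sq: "\<And>i. i \<in> I \<Longrightarrow> expectation (\<lambda>\<omega>. (Z i \<omega>)\<^sup>2) \<le> q"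
  shows "expectation (\<lambda>\<omega>. \<bar>\<Sum>i\<in>I. Z i \<omega>\<bar>) \<le> sqrt (card I * q)"
proof (rule expectation_abs_le_sqrt)
  have int: "integrable M (\<lambda>\<omega>. Z i \<omega> * Z j \<omega>)" if "i \<in> I" "j \<in> I" for i j
  proof (rule integrable_const_bound[where B = 1], rule AE_I2)
    fix \<omega> assume "\<omega> \<in> space M"
    then have "\<bar>Z i \<omega>\<bar> * \<bar>Z j \<omega>\<bar> \<le> 1 * 1" using bounded that by (intro mult_mono) auto
    then show "norm (Z i \<omega> * Z j \<omega>) \<le> 1" by (simp add: abs_mult)
  qed (use that in simp)
  have expand: "(\<lambda>\<omega>. (\<Sum>i\<in>I. Z i \<omega>)\<^sup>2) = (\<lambda>\<omega>. \<Sum>i\<in>I. \<Sum>j\<in>I. Z i \<omega> * Z j \<omega>)"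
    by (simp add: power2_eq_square sum_product)
  show "integrable M (\<lambda>\<omega>. (\<Sum>i\<in>I. Z i \<omega>)\<^sup>2)"
    unfolding expand by (intro Bochner_Integration.integrable_sum int)
  have "expectation (\<lambda>\<omega>. (\<Sum>i\<in>I. Z i \<omega>)\<^sup>2) = (\<Sum>i\<in>I. \<Sum>j\<in>I. expectation (\<lambda>\<omega>. Z i \<omega> * Z j \<omega>))"
    unfolding expand using int by (simp add: Bochner_Integration.integral_sum)
  also have "\<dots> = (\<Sum>i\<in>I. \<Sum>j\<in>I. if j = i then expectation (\<lambda>\<omega>. (Z i \<omega>)\<^sup>2) else 0)"
    by (intro sum.cong refl) (auto simp: orth power2_eq_square)
  also have "\<dots> = (\<Sum>i\<in>I. expectation (\<lambda>\<omega>. (Z i \<omega>)\<^sup>2))" using I by simp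
  also have "\<dots> \<le> card I * q" using sq sum_bounded_above[of I _ q] by simp
  finally show "expectation (\<lambda>\<omega>. (\<Sum>i\<in>I. Z i \<omega>)\<^sup>2) \<le> card I * q" .
qed measurable

section \<open>Invariance of the observed matrix and the exchange bound\<close>

definition anonymized :: "nat \<Rightarrow> nat \<Rightarrow> (nat \<times> nat \<Rightarrow> nat) \<Rightarrow> (nat \<Rightarrow> nat) \<Rightarrow> nat \<times> nat \<Rightarrow> nat" where
  "anonymized m n x \<pi> = (\<lambda>(t, j)\<in>{1..m} \<times> {1..n}. x (inv \<pi> j, t))"

text \<open>The inverse of the composed permutation sends a column through the transposition, and
  the exchanged trajectories apply the transposition once more; the two cancel.\<close>

lemma anonymized_swap:
  assumes "\<pi> permutes {1..n}"
  shows "anonymized m n (\<lambda>(v, t). x (Transposition.transpose 1 u v, t)) (\<pi> \<circ> Transposition.transpose 1 u) = anonymized m n x \<pi>"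
proof -
  have "inv (\<pi> \<circ> Transposition.transpose 1 u) = Transposition.transpose 1 u \<circ> inv \<pi>"
    using permutes_bij[OF assms] by (subst o_inv_distrib) (auto simp: bij_swap_iff)
  then show ?thesis by (simp add: anonymized_def)
qed

context anonymized_two_state_model
begin

lemma events_pattern_Perm:
  assumes "\<pi> permutes {1..n}" "x \<in> {1..n} \<times> {1..m} \<rightarrow>\<^sub>E {0, 1}"
  shows "{\<omega> \<in> space M. X_upto n m \<omega> = x \<and> Perm n \<omega> = \<pi>} \<in> events"
proof (rule sets.sets_Collect_conj)
  have "{\<omega> \<in> space M. \<forall>j\<in>{1..n} \<times> {1..m}. X (fst j) (snd j) \<omega> = x j} \<in> events"
    by (intro sets.sets_Collect_finite_All events_X) auto
  also have "{\<omega> \<in> space M. \<forall>j\<in>{1..n} \<times> {1..m}. X (fst j) (snd j) \<omega> = x j} = {\<omega> \<in> space M. X_upto n m \<omega> = x}"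
    using assms(2) by (auto simp: X_upto_def fun_eq_iff PiE_def extensional_def)
  finally show "{\<omega> \<in> space M. X_upto n m \<omega> = x} \<in> events" .
  have "Perm n -` {\<pi>} \<inter> space M \<in> events"
    using assms(1) by (intro measurable_sets[OF Perm_measurable]) simp
  then show "{\<omega> \<in> space M. Perm n \<omega> = \<pi>} \<in> events" by (simp add: vimage_def Int_def conj_commute)
qed

lemma integrable_weight:
  assumes x: "x \<in> {1..n} \<times> {1..m} \<rightarrow>\<^sub>E {0, 1}"
    and g: "g \<in> borel_measurable (Pi\<^sub>M {1..n} (\<lambda>_. borel))" and bounded: "\<And>P. \<bar>g P\<bar> \<le> B"
  shows "integrable M (\<lambda>\<omega>. g (p_upto n \<omega>) * weight n m (p_upto n \<omega>) x)"
proof -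
  have "integrable M (\<lambda>\<omega>. g (p_upto n \<omega>) * (\<Prod>j\<in>{1..n} \<times> {1..m}. bern (p (fst j) \<omega>) (x j)))"
    by (rule expectation_pattern(1)[where B = B])
      (use x bounded measurable_compose[OF p_upto_measurable_p_algebra g] in \<open>auto simp del: One_nat_def\<close>)
  also have "(\<lambda>\<omega>. g (p_upto n \<omega>) * (\<Prod>j\<in>{1..n} \<times> {1..m}. bern (p (fst j) \<omega>) (x j))) =
      (\<lambda>\<omega>. g (p_upto n \<omega>) * weight n m (p_upto n \<omega>) x)"
    unfolding weight_def by (intro ext arg_cong2[where f = "(*)"] refl prod.cong) (auto simp: p_upto_def)
  finally show ?thesis .
qed

text \<open>Trajectories and permutations take finitely many values, so only the parameters stay
  under the expectation. An exchange of users can then be carried out by reindexing two finite sums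
  while the parameters remain fixed.\<close>

lemma expectation_joint:
  fixes H :: "(nat \<Rightarrow> real) \<Rightarrow> (nat \<times> nat \<Rightarrow> nat) \<Rightarrow> (nat \<Rightarrow> nat) \<Rightarrow> real"
  assumes H: "\<And>x \<pi>. x \<in> {1..n} \<times> {1..m} \<rightarrow>\<^sub>E {0, 1} \<Longrightarrow> \<pi> permutes {1..n} \<Longrightarrow>
      (\<lambda>P. H P x \<pi>) \<in> borel_measurable (Pi\<^sub>M {1..n} (\<lambda>_. borel))"
    and bounded: "\<And>P x \<pi>. x \<in> {1..n} \<times> {1..m} \<rightarrow>\<^sub>E {0, 1} \<Longrightarrow> \<pi> permutes {1..n} \<Longrightarrow> \<bar>H P x \<pi>\<bar> \<le> B"
  shows "expectation (\<lambda>\<omega>. H (p_upto n \<omega>) (X_upto n m \<omega>) (Perm n \<omega>)) =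
    (\<Sum>x\<in>{1..n} \<times> {1..m} \<rightarrow>\<^sub>E {0, 1}. \<Sum>\<pi> | \<pi> permutes {1..n}.
      expectation (\<lambda>\<omega>. H (p_upto n \<omega>) x \<pi> * weight n m (p_upto n \<omega>) x)) / card {\<pi>. \<pi> permutes {1..n}}"
proof -
  let ?W = "{1..n} \<times> {1..m} \<rightarrow>\<^sub>E {0, 1 :: nat}" and ?S = "{\<pi>. \<pi> permutes {1..n}}"
  let ?E = "\<lambda>x \<pi>. {\<omega> \<in> space M. X_upto n m \<omega> = x \<and> Perm n \<omega> = \<pi>}"
  have finW: "finite ?W" by (intro finite_PiE) auto
  have finS: "finite ?S" by (intro finite_permutations) simp
  have int: "integrable M (\<lambda>\<omega>. H (p_upto n \<omega>) x \<pi> * indicator (?E x \<pi>) \<omega>)" if "x \<in> ?W" "\<pi> \<in> ?S" for x \<pi>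
  proof (rule integrable_const_bound[where B = "\<bar>B\<bar>"], rule AE_I2)
    fix \<omega>
    show "norm (H (p_upto n \<omega>) x \<pi> * indicator (?E x \<pi>) \<omega>) \<le> \<bar>B\<bar>"
      using bounded[of x \<pi> "p_upto n \<omega>"] that by (auto split: split_indicator)
    show "(\<lambda>\<omega>. H (p_upto n \<omega>) x \<pi> * indicator (?E x \<pi>) \<omega>) \<in> borel_measurable M"
      using that by (intro borel_measurable_times measurable_compose[OF p_upto_measurable H]
        borel_measurable_indicator events_pattern_Perm) auto
  qed
  have "expectation (\<lambda>\<omega>. H (p_upto n \<omega>) (X_upto n m \<omega>) (Perm n \<omega>)) =
      expectation (\<lambda>\<omega>. \<Sum>x\<in>?W. \<Sum>\<pi>\<in>?S. H (p_upto n \<omega>) x \<pi> * indicator (?E x \<pi>) \<omega>)"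
  proof (rule Bochner_Integration.integral_cong[OF refl])
    fix \<omega> assume \<omega>: "\<omega> \<in> space M"
    have X: "X_upto n m \<omega> \<in> ?W"
    proof (rule PiE_I)
      fix j assume "j \<in> {1..n} \<times> {1..m}"
      then show "X_upto n m \<omega> j \<in> {0, 1}"
        using X_values[of "fst j" "snd j", OF _ _ \<omega>] by (auto simp: X_upto_def)
    qed (auto simp: X_upto_def)
    have Perm: "Perm n \<omega> \<in> ?S" using measurable_space[OF Perm_measurable \<omega>] by simp
    have "(\<Sum>x\<in>?W. \<Sum>\<pi>\<in>?S. H (p_upto n \<omega>) x \<pi> * indicator (?E x \<pi>) \<omega>) =
       (\<Sum>x\<in>?W. if x = X_upto n m \<omega> then \<Sum>\<pi>\<in>?S. if \<pi> = Perm n \<omega> then H (p_upto n \<omega>) x \<pi> else 0 else 0)"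
    proof (rule sum.cong[OF refl])
      fix x
      show "(\<Sum>\<pi>\<in>?S. H (p_upto n \<omega>) x \<pi> * indicator (?E x \<pi>) \<omega>) =
        (if x = X_upto n m \<omega> then \<Sum>\<pi>\<in>?S. if \<pi> = Perm n \<omega> then H (p_upto n \<omega>) x \<pi> else 0 else 0)"
      proof (cases "x = X_upto n m \<omega>")
        case True
        then show ?thesis using \<omega> by (auto intro!: sum.cong simp: indicator_def)
      next
        case False
        then show ?thesis by simp
      qed
    qed
    also have "\<dots> = H (p_upto n \<omega>) (X_upto n m \<omega>) (Perm n \<omega>)"
      by (simp only: sum.delta[OF finW] sum.delta[OF finS] X Perm if_True)
    finally show "H (p_upto n \<omega>) (X_upto n m \<omega>) (Perm n \<omega>) =
       (\<Sum>x\<in>?W. \<Sum>\<pi>\<in>?S. H (p_upto n \<omega>) x \<pi> * indicator (?E x \<pi>) \<omega>)" ..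
  qed
  also have "\<dots> = (\<Sum>x\<in>?W. \<Sum>\<pi>\<in>?S. expectation (\<lambda>\<omega>. H (p_upto n \<omega>) x \<pi> * indicator (?E x \<pi>) \<omega>))"
  proof -
    have "expectation (\<lambda>\<omega>. \<Sum>x\<in>?W. \<Sum>\<pi>\<in>?S. H (p_upto n \<omega>) x \<pi> * indicator (?E x \<pi>) \<omega>) =
        (\<Sum>x\<in>?W. expectation (\<lambda>\<omega>. \<Sum>\<pi>\<in>?S. H (p_upto n \<omega>) x \<pi> * indicator (?E x \<pi>) \<omega>))"
      by (intro Bochner_Integration.integral_sum Bochner_Integration.integrable_sum int)
    also have "\<dots> = (\<Sum>x\<in>?W. \<Sum>\<pi>\<in>?S. expectation (\<lambda>\<omega>. H (p_upto n \<omega>) x \<pi> * indicator (?E x \<pi>) \<omega>))"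
      by (intro sum.cong refl Bochner_Integration.integral_sum int)
    finally show ?thesis .
  qed
  also have "\<dots> = (\<Sum>x\<in>?W. \<Sum>\<pi>\<in>?S. expectation (\<lambda>\<omega>. H (p_upto n \<omega>) x \<pi> * weight n m (p_upto n \<omega>) x) / card ?S)"
  proof (intro sum.cong refl)
    fix x \<pi> assume x: "x \<in> ?W" and \<pi>: "\<pi> \<in> ?S"
    show "expectation (\<lambda>\<omega>. H (p_upto n \<omega>) x \<pi> * indicator (?E x \<pi>) \<omega>) =
      expectation (\<lambda>\<omega>. H (p_upto n \<omega>) x \<pi> * weight n m (p_upto n \<omega>) x) / card ?S"
      using \<pi> by (intro expectation_pattern_Perm[where B = B] x H bounded) auto
  qed
  finally show ?thesis by (simp only: sum_divide_distrib)
qed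

lemma observation_eq_anonymized:
  assumes "\<omega> \<in> space M"
  shows "observation X Perm m n \<omega> = anonymized m n (X_upto n m \<omega>) (Perm n \<omega>)"
proof -
  have "Perm n \<omega> permutes {1..n}" using measurable_space[OF Perm_measurable assms] by simp
  then have "inv (Perm n \<omega>) j \<in> {1..n}" if "j \<in> {1..n}" for j
    using permutes_in_image[OF permutes_inv[OF \<open>Perm n \<omega> permutes {1..n}\<close>], of j] that by simp
  note inv = this
  show ?thesis
    unfolding observation_def anonymized_def
  proof (rule restrict_ext)
    fix z assume "z \<in> {1..m} \<times> {1..n}"
    then show "(case z of (t, j) \<Rightarrow> X (inv (Perm n \<omega>) j) t \<omega>) =
        (case z of (t, j) \<Rightarrow> X_upto n m \<omega> (inv (Perm n \<omega>) j, t))"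
      using inv[of "snd z"] by (auto simp: X_upto_def)
  qed
qed

definition near :: "real \<Rightarrow> real \<Rightarrow> real" where
  "near \<epsilon> q = (if \<bar>q - p1\<bar> \<le> \<epsilon> then 1 else 0)"

lemma near_measurable[measurable]: "near \<epsilon> \<in> borel_measurable borel"
  unfolding near_def[abs_def] by measurable

lemma near_abs_le: "\<bar>near \<epsilon> q\<bar> \<le> 1" "0 \<le> near \<epsilon> q"
  by (auto simp: near_def)

text \<open>Reindexing by the exchange replaces the location of user 1 by that of user
  \<open>u\<close>, keeps the observed matrix, and leaves the discrepancy in the weight alone. The
  factor \<open>near\<close> stays inside the expectation, so the error is proportional to its mean;
  summed over all users it is then proportional to the expected number of close users instead of to
  \<open>n\<close>.\<close>

lemma swap_deviation_le:
  assumes u: "u \<in> {2..n}" and k: "k \<in> {1..m}"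
    and A: "A \<in> sets (observation_space m n \<Otimes>\<^sub>M Pi\<^sub>M {1..n} (\<lambda>_. borel))"
    and p01: "\<And>v. v \<ge> 1 \<Longrightarrow> AE \<omega> in M. 0 < p v \<omega> \<and> p v \<omega> < 1"
    and \<kappa>: "0 < \<kappa>" "\<And>q. \<bar>q - p1\<bar> \<le> \<epsilon> \<Longrightarrow> \<kappa> \<le> q * (1 - q)" and \<epsilon>: "0 \<le> \<epsilon>"
  shows "\<bar>expectation (\<lambda>\<omega>. near \<epsilon> (p u \<omega>) * real (X 1 k \<omega>) * indicator A (observation X Perm m n \<omega>, p_upto n \<omega>)) -
      expectation (\<lambda>\<omega>. near \<epsilon> (p u \<omega>) * real (X u k \<omega>) * indicator A (observation X Perm m n \<omega>, p_upto n \<omega>))\<bar>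
    \<le> sqrt (exp (2 * real m * \<epsilon>\<^sup>2 / \<kappa>) - 1) * expectation (\<lambda>\<omega>. near \<epsilon> (p u \<omega>))"
proof -
  define W where "W = {1..n} \<times> {1..m} \<rightarrow>\<^sub>E {0, 1 :: nat}"
  define S where "S = {\<pi>. \<pi> permutes {1..n}}"
  define T where "T = sqrt (exp (2 * real m * \<epsilon>\<^sup>2 / \<kappa>) - 1)"
  define \<sigma> where "\<sigma> = Transposition.transpose 1 u"
  define swap where "swap = (\<lambda>x :: nat \<times> nat \<Rightarrow> nat. \<lambda>(v, t). x (\<sigma> v, t))"
  define H where "H = (\<lambda>v P x \<pi>. near \<epsilon> (P u) * real (x (v, k)) * indicator A (anonymized m n x \<pi>, P))"
  define w where "w = (\<lambda>\<omega> x. weight n m (p_upto n \<omega>) x)"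
  define N where "N = (\<lambda>\<omega>. near \<epsilon> (p_upto n \<omega> u))"
  have u1: "1 \<in> {1..n}" "u \<in> {1..n}" "u \<ge> 1" using u by auto
  have finS: "finite S" unfolding S_def by (intro finite_permutations) simp
  have finW: "finite W" unfolding W_def by (intro finite_PiE) auto
  have \<sigma>: "\<sigma> permutes {1..n}" unfolding \<sigma>_def using u1 by (intro permutes_swap_id) auto
  have N_eq: "N \<omega> = near \<epsilon> (p u \<omega>)" for \<omega> using u1 by (simp add: N_def p_upto_def)
  have near_m: "(\<lambda>P. near \<epsilon> (P u)) \<in> borel_measurable (Pi\<^sub>M {1..n} (\<lambda>_. borel))"
  proof -
    have "(\<lambda>P. P u) \<in> borel_measurable (Pi\<^sub>M {1..n} (\<lambda>_. borel))"
      using u1 by (intro measurable_component_singleton)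
    then show ?thesis by (rule measurable_compose) (rule near_measurable)
  qed
  have Hm: "(\<lambda>P. H v P x \<pi>) \<in> borel_measurable (Pi\<^sub>M {1..n} (\<lambda>_. borel))" for v x \<pi>
  proof -
    have "(\<lambda>P. indicator (Pair (anonymized m n x \<pi>) -` A) P :: real) \<in> borel_measurable (Pi\<^sub>M {1..n} (\<lambda>_. borel))"
      by (intro borel_measurable_indicator sets_Pair1[OF A])
    then have "(\<lambda>P. indicator A (anonymized m n x \<pi>, P) :: real) \<in> borel_measurable (Pi\<^sub>M {1..n} (\<lambda>_. borel))"
      by (simp add: indicator_def vimage_def)
    then show ?thesis unfolding H_def by (intro borel_measurable_times near_m) simp_all
  qed
  have Hb: "\<bar>H v P x \<pi>\<bar> \<le> near \<epsilon> (P u)" if "x \<in> W" "v \<in> {1..n}" for v P x \<pi>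
  proof -
    have "x (v, k) \<in> {0, 1}" using that k unfolding W_def by (intro PiE_mem[of x]) auto
    then show ?thesis by (auto simp: H_def near_def indicator_def)
  qed
  have Hb1: "\<bar>H v P x \<pi>\<bar> \<le> 1" if "x \<in> W" "v \<in> {1..n}" for v P x \<pi>
    using Hb[OF that, of P \<pi>] near_abs_le[of \<epsilon> "P u"] by linarith
  have joint: "expectation (\<lambda>\<omega>. near \<epsilon> (p u \<omega>) * real (X v k \<omega>) * indicator A (observation X Perm m n \<omega>, p_upto n \<omega>)) =
    (\<Sum>x\<in>W. \<Sum>\<pi>\<in>S. expectation (\<lambda>\<omega>. H v (p_upto n \<omega>) x \<pi> * w \<omega> x)) / card S" if v: "v \<in> {1..n}" for v
  proof -
    have "expectation (\<lambda>\<omega>. near \<epsilon> (p u \<omega>) * real (X v k \<omega>) * indicator A (observation X Perm m n \<omega>, p_upto n \<omega>)) =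
        expectation (\<lambda>\<omega>. H v (p_upto n \<omega>) (X_upto n m \<omega>) (Perm n \<omega>))"
      using v k u1 by (intro Bochner_Integration.integral_cong refl)
        (simp add: H_def observation_eq_anonymized p_upto_def X_upto_def)
    also have "\<dots> = (\<Sum>x\<in>W. \<Sum>\<pi>\<in>S. expectation (\<lambda>\<omega>. H v (p_upto n \<omega>) x \<pi> * w \<omega> x)) / card S"
      unfolding W_def S_def w_def
      by (rule expectation_joint[where B = 1]) (use Hm Hb1 v in \<open>auto simp: W_def simp del: One_nat_def\<close>)
    finally show ?thesis .
  qed
  have swap: "bij_betw swap W W" unfolding swap_def \<sigma>_def W_def by (rule bij_betw_swap_rows[OF u1(2)])
  have swapW: "swap x \<in> W" if "x \<in> W" for x using swap that by (rule bij_betwE[THEN bspec])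
  have comp: "bij_betw (\<lambda>\<pi>. \<pi> \<circ> \<sigma>) S S" unfolding S_def by (rule bij_betw_permutes_compose[OF \<sigma>])
  \<comment> \<open>The parameter vector \<open>P\<close> is the same on both sides: it is part of
    what the adversary sees and takes no part in the exchange.\<close>
  have H_swap: "H 1 P (swap x) (\<pi> \<circ> \<sigma>) = H u P x \<pi>" if "\<pi> \<in> S" for P x \<pi>
    using that anonymized_swap[of \<pi> n m x u] by (simp add: H_def swap_def \<sigma>_def S_def)
  have w_swap: "w \<omega> (swap x) = weight n m (p_upto n \<omega> \<circ> \<sigma>) x" for \<omega> x
    unfolding w_def swap_def \<sigma>_def by (rule weight_swap[OF u1(2)])
  have int: "integrable M (\<lambda>\<omega>. H v (p_upto n \<omega>) x \<pi> * w \<omega> x')" if "x \<in> W" "x' \<in> W" "v \<in> {1..n}" for v x x' \<pi>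
    unfolding w_def
    by (rule integrable_weight[where B = 1]) (use that Hm Hb1 in \<open>auto simp: W_def simp del: One_nat_def\<close>)
  have intN: "integrable M (\<lambda>\<omega>. N \<omega> * w \<omega> x)" if "x \<in> W" for x
    unfolding w_def N_def
    by (rule integrable_weight[where B = 1]) (use that near_m near_abs_le in \<open>auto simp: W_def simp del: One_nat_def\<close>)
  have intD: "integrable M (\<lambda>\<omega>. N \<omega> * \<bar>w \<omega> (swap x) - w \<omega> x\<bar>)" if "x \<in> W" for x
  proof -
    have "integrable M (\<lambda>\<omega>. \<bar>N \<omega> * w \<omega> (swap x) - N \<omega> * w \<omega> x\<bar>)"
      using intN[OF that] intN[OF swapW[OF that]] by (intro integrable_abs Bochner_Integration.integrable_diff)
    moreover have "\<bar>N \<omega> * w \<omega> (swap x) - N \<omega> * w \<omega> x\<bar> = N \<omega> * \<bar>w \<omega> (swap x) - w \<omega> x\<bar>" for \<omega>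
      using near_abs_le(2)[of \<epsilon> "p_upto n \<omega> u"] by (simp add: N_def abs_mult flip: right_diff_distrib)
    ultimately show ?thesis by simp
  qed
  let ?D = "\<lambda>x \<pi>. expectation (\<lambda>\<omega>. H u (p_upto n \<omega>) x \<pi> * w \<omega> (swap x)) -
     expectation (\<lambda>\<omega>. H u (p_upto n \<omega>) x \<pi> * w \<omega> x)"
  \<comment> \<open>Both sums are reindexed, trajectories by \<open>swap\<close> and permutations by
    composition with \<open>\<sigma>\<close>. The weight does not depend on the permutation, so the
    second reindexing affects \<open>H\<close> only.\<close>
  have "(\<Sum>x\<in>W. \<Sum>\<pi>\<in>S. expectation (\<lambda>\<omega>. H 1 (p_upto n \<omega>) x \<pi> * w \<omega> x)) =
      (\<Sum>x\<in>W. \<Sum>\<pi>\<in>S. expectation (\<lambda>\<omega>. H 1 (p_upto n \<omega>) (swap x) \<pi> * w \<omega> (swap x)))"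
    by (rule sum.reindex_bij_betw[OF swap, symmetric])
  also have "\<dots> = (\<Sum>x\<in>W. \<Sum>\<pi>\<in>S. expectation (\<lambda>\<omega>. H 1 (p_upto n \<omega>) (swap x) (\<pi> \<circ> \<sigma>) * w \<omega> (swap x)))"
    by (intro sum.cong refl sum.reindex_bij_betw[OF comp, symmetric])
  also have "\<dots> = (\<Sum>x\<in>W. \<Sum>\<pi>\<in>S. expectation (\<lambda>\<omega>. H u (p_upto n \<omega>) x \<pi> * w \<omega> (swap x)))"
    by (intro sum.cong refl) (simp only: H_swap)
  finally have "\<bar>expectation (\<lambda>\<omega>. near \<epsilon> (p u \<omega>) * real (X 1 k \<omega>) * indicator A (observation X Perm m n \<omega>, p_upto n \<omega>)) -
      expectation (\<lambda>\<omega>. near \<epsilon> (p u \<omega>) * real (X u k \<omega>) * indicator A (observation X Perm m n \<omega>, p_upto n \<omega>))\<bar> =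
      \<bar>(\<Sum>x\<in>W. \<Sum>\<pi>\<in>S. ?D x \<pi>) / card S\<bar>"
    unfolding joint[OF u1(1)] joint[OF u1(2)] by (simp only: diff_divide_distrib[symmetric] sum_subtractf)
  also have "\<dots> \<le> (\<Sum>x\<in>W. \<Sum>\<pi>\<in>S. \<bar>?D x \<pi>\<bar>) / card S"
    unfolding abs_divide abs_of_nat by (intro divide_right_mono order.trans[OF sum_abs] sum_mono sum_abs) simp
  also have "\<dots> \<le> (\<Sum>x\<in>W. \<Sum>\<pi>\<in>S. expectation (\<lambda>\<omega>. N \<omega> * \<bar>w \<omega> (swap x) - w \<omega> x\<bar>)) / card S"
  proof (intro divide_right_mono sum_mono)
    fix x \<pi> assume x: "x \<in> W"
    have i1: "integrable M (\<lambda>\<omega>. \<bar>H u (p_upto n \<omega>) x \<pi> * w \<omega> (swap x) - H u (p_upto n \<omega>) x \<pi> * w \<omega> x\<bar>)"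
      by (rule integrable_abs[OF Bochner_Integration.integrable_diff[OF int[OF x swapW[OF x] u1(2)] int[OF x x u1(2)]]])
    have pointwise: "\<bar>H u (p_upto n \<omega>) x \<pi> * w \<omega> (swap x) - H u (p_upto n \<omega>) x \<pi> * w \<omega> x\<bar>
        \<le> N \<omega> * \<bar>w \<omega> (swap x) - w \<omega> x\<bar>" for \<omega>
      unfolding N_def right_diff_distrib[symmetric] abs_mult
      by (rule mult_right_mono[OF Hb[OF x u1(2)]]) simp
    have "\<bar>?D x \<pi>\<bar> = \<bar>expectation (\<lambda>\<omega>. H u (p_upto n \<omega>) x \<pi> * w \<omega> (swap x) - H u (p_upto n \<omega>) x \<pi> * w \<omega> x)\<bar>"
      using int[OF x x u1(2)] int[OF x swapW[OF x] u1(2)] by simp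
    also have "\<dots> \<le> expectation (\<lambda>\<omega>. \<bar>H u (p_upto n \<omega>) x \<pi> * w \<omega> (swap x) - H u (p_upto n \<omega>) x \<pi> * w \<omega> x\<bar>)"
      by (rule integral_abs_bound)
    also have "\<dots> \<le> expectation (\<lambda>\<omega>. N \<omega> * \<bar>w \<omega> (swap x) - w \<omega> x\<bar>)"
      by (rule integral_mono[OF i1 intD[OF x] pointwise])
    finally show "\<bar>?D x \<pi>\<bar> \<le> expectation (\<lambda>\<omega>. N \<omega> * \<bar>w \<omega> (swap x) - w \<omega> x\<bar>)" .
  qed simp
  \<comment> \<open>The bound no longer depends on the permutation, so the sum over \<open>S\<close>
    cancels against \<open>card S\<close>.\<close>
  also have "\<dots> = (\<Sum>x\<in>W. expectation (\<lambda>\<omega>. N \<omega> * \<bar>w \<omega> (swap x) - w \<omega> x\<bar>))"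
  proof -
    have "id \<in> S" by (simp add: S_def permutes_id)
    then have "card S \<noteq> 0" using finS by auto
    then show ?thesis by (simp add: sum_distrib_left[symmetric])
  qed
  also have "\<dots> = expectation (\<lambda>\<omega>. \<Sum>x\<in>W. N \<omega> * \<bar>w \<omega> (swap x) - w \<omega> x\<bar>)"
    by (rule Bochner_Integration.integral_sum[symmetric]) (rule intD)
  \<comment> \<open>For fixed parameters there are two cases: \<open>N\<close> vanishes, or user
    \<open>u\<close> is close to user 1 and the L1 bound for exchanged weights applies.\<close>
  also have "\<dots> \<le> expectation (\<lambda>\<omega>. T * N \<omega>)"
  proof (rule integral_mono_AE)
    show "integrable M (\<lambda>\<omega>. \<Sum>x\<in>W. N \<omega> * \<bar>w \<omega> (swap x) - w \<omega> x\<bar>)"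
      by (intro Bochner_Integration.integrable_sum intD)
    show "integrable M (\<lambda>\<omega>. T * N \<omega>)"
    proof (intro integrable_mult_right integrable_const_bound[where B = 1])
      show "AE \<omega> in M. norm (N \<omega>) \<le> 1" by (simp add: N_def near_def)
      show "N \<in> borel_measurable M"
        unfolding N_def by (rule measurable_compose[OF p_upto_measurable near_m])
    qed
    have "AE \<omega> in M. \<forall>v\<in>{1..n}. 0 < p v \<omega> \<and> p v \<omega> < 1"
      by (rule AE_finite_allI) (use p01 in auto)
    then show "AE \<omega> in M. (\<Sum>x\<in>W. N \<omega> * \<bar>w \<omega> (swap x) - w \<omega> x\<bar>) \<le> T * N \<omega>"
      using AE_space
    proof eventually_elim
      case (elim \<omega>)
      show ?case
      proof (cases "\<bar>p u \<omega> - p1\<bar> \<le> \<epsilon>")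
        case True
        have "(\<Sum>x\<in>W. \<bar>w \<omega> (swap x) - w \<omega> x\<bar>) \<le> T"
          unfolding w_swap unfolding w_def W_def T_def \<sigma>_def
        proof (rule weight_swap_l1_le[OF _ u \<kappa>(1)])
          show "0 < p_upto n \<omega> v \<and> p_upto n \<omega> v < 1" if "v \<in> {1..n}" for v
            using elim that by (simp add: p_upto_def)
          show "\<kappa> \<le> p_upto n \<omega> 1 * (1 - p_upto n \<omega> 1)"
            using \<kappa>(2)[of p1] \<epsilon> u1 elim p_first[of \<omega>] by (simp add: p_upto_def)
          show "\<kappa> \<le> p_upto n \<omega> u * (1 - p_upto n \<omega> u)"
            using \<kappa>(2)[OF True] u1 by (simp add: p_upto_def)
          show "\<bar>p_upto n \<omega> u - p_upto n \<omega> 1\<bar> \<le> \<epsilon>"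
            using True u1 elim p_first[of \<omega>] by (simp add: p_upto_def)
        qed
        then show ?thesis using True by (simp add: N_eq near_def)
      next
        case False
        then show ?thesis by (simp add: N_eq near_def)
      qed
    qed
  qed
  finally show ?thesis by (simp add: T_def N_eq)
qed

end

section \<open>Averaging over the users close to user 1\<close>

context anonymized_two_state_model
begin

lemma integrable_bounded:
  fixes g :: "'a \<Rightarrow> real"
  assumes "g \<in> borel_measurable M" "\<And>\<omega>. \<omega> \<in> space M \<Longrightarrow> \<bar>g \<omega>\<bar> \<le> B"
  shows "integrable M g"
  by (rule integrable_const_bound[where B = B, OF _ assms(1)]) (use assms(2) in \<open>auto intro!: AE_I2\<close>)

lemma expectation_mult_X:
  assumes u: "u \<ge> 1" "k \<ge> 1"
    and h: "h \<in> borel_measurable p_algebra" "\<And>\<omega>. \<omega> \<in> space M \<Longrightarrow> \<bar>h \<omega>\<bar> \<le> B"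
  shows "expectation (\<lambda>\<omega>. h \<omega> * real (X u k \<omega>)) = expectation (\<lambda>\<omega>. h \<omega> * p u \<omega>)"
proof -
  have "expectation (\<lambda>\<omega>. h \<omega> * real (X u k \<omega>)) =
      expectation (\<lambda>\<omega>. h \<omega> * indicator {\<omega> \<in> space M. \<forall>j\<in>{(u, k)}. X (fst j) (snd j) \<omega> = 1} \<omega>)"
  proof (rule Bochner_Integration.integral_cong[OF refl])
    fix \<omega> assume "\<omega> \<in> space M"
    then show "h \<omega> * real (X u k \<omega>) = h \<omega> * indicator {\<omega> \<in> space M. \<forall>j\<in>{(u, k)}. X (fst j) (snd j) \<omega> = 1} \<omega>"
      using X_values[OF u, of \<omega>] by (auto simp: indicator_def)
  qed
  also have "\<dots> = expectation (\<lambda>\<omega>. h \<omega> * (\<Prod>j\<in>{(u, k)}. bern (p (fst j) \<omega>) 1))"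
    by (rule expectation_pattern(2)[OF _ _ _ h]) (use u in auto)
  finally show ?thesis by (simp add: bern_def)
qed

lemma expectation_mult_X_X:
  assumes u: "u \<ge> 1" "v \<ge> 1" "u \<noteq> v" "k \<ge> 1"
    and h: "h \<in> borel_measurable p_algebra" "\<And>\<omega>. \<omega> \<in> space M \<Longrightarrow> \<bar>h \<omega>\<bar> \<le> B"
  shows "expectation (\<lambda>\<omega>. h \<omega> * (real (X u k \<omega>) * real (X v k \<omega>))) = expectation (\<lambda>\<omega>. h \<omega> * (p u \<omega> * p v \<omega>))"
proof -
  have "expectation (\<lambda>\<omega>. h \<omega> * (real (X u k \<omega>) * real (X v k \<omega>))) =
      expectation (\<lambda>\<omega>. h \<omega> * indicator {\<omega> \<in> space M. \<forall>j\<in>{(u, k), (v, k)}. X (fst j) (snd j) \<omega> = 1} \<omega>)"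
  proof (rule Bochner_Integration.integral_cong[OF refl])
    fix \<omega> assume "\<omega> \<in> space M"
    then show "h \<omega> * (real (X u k \<omega>) * real (X v k \<omega>)) =
        h \<omega> * indicator {\<omega> \<in> space M. \<forall>j\<in>{(u, k), (v, k)}. X (fst j) (snd j) \<omega> = 1} \<omega>"
      using X_values[OF u(1,4), of \<omega>] X_values[OF u(2,4), of \<omega>] by (auto simp: indicator_def)
  qed
  also have "\<dots> = expectation (\<lambda>\<omega>. h \<omega> * (\<Prod>j\<in>{(u, k), (v, k)}. bern (p (fst j) \<omega>) 1))"
    by (rule expectation_pattern(2)[OF _ _ _ h]) (use u in auto)
  finally show ?thesis using u(3) by (simp add: bern_def)
qed

lemma near_p_measurable_p_algebra:
  assumes "u \<ge> 1"
  shows "(\<lambda>\<omega>. near \<epsilon> (p u \<omega>)) \<in> borel_measurable p_algebra"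
  by (rule measurable_compose[OF p_measurable_p_algebra[OF assms] near_measurable])

lemma near_p_measurable:
  assumes "u \<ge> 1"
  shows "(\<lambda>\<omega>. near \<epsilon> (p u \<omega>)) \<in> borel_measurable M"
  by (rule measurable_compose[OF p_measurable[OF assms] near_measurable])

text \<open>Closeness to \<open>p1\<close> bounds the parameter itself. This makes
  \<open>near \<epsilon> q * q\<close> usable as a bounded factor even where the parameters are not
  known to lie in the unit interval.\<close>

lemma abs_near_mult_le: "\<bar>near \<epsilon> q * q\<bar> \<le> \<bar>p1\<bar> + \<bar>\<epsilon>\<bar>"
  by (auto simp: near_def)

text \<open>Given the parameters, the locations of two different users are independent with means
  \<open>p u\<close> and \<open>p v\<close>. Hence all four terms of the expanded product have the
  same expectation \<open>t\<close> up to sign, and the signs cancel.\<close>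

lemma expectation_centered_orthogonal:
  assumes u: "u \<ge> 1" "v \<ge> 1" "u \<noteq> v" "k \<ge> 1"
  shows "expectation (\<lambda>\<omega>. (near \<epsilon> (p u \<omega>) * (real (X u k \<omega>) - p u \<omega>)) * (near \<epsilon> (p v \<omega>) * (real (X v k \<omega>) - p v \<omega>))) = 0"
proof -
  define C where "C = \<bar>p1\<bar> + \<bar>\<epsilon>\<bar>"
  define a where "a = (\<lambda>\<omega>. near \<epsilon> (p u \<omega>))"
  define a' where "a' = (\<lambda>\<omega>. near \<epsilon> (p u \<omega>) * p u \<omega>)"
  define d where "d = (\<lambda>\<omega>. near \<epsilon> (p v \<omega>))"
  define d' where "d' = (\<lambda>\<omega>. near \<epsilon> (p v \<omega>) * p v \<omega>)"
  have F: "a \<in> borel_measurable p_algebra" "a' \<in> borel_measurable p_algebra"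
      "d \<in> borel_measurable p_algebra" "d' \<in> borel_measurable p_algebra"
    unfolding a_def a'_def d_def d'_def
    by (intro borel_measurable_times near_p_measurable_p_algebra p_measurable_p_algebra u)+
  note M = F[THEN measurable_from_subalg[OF subalgebra_p]]
  have x: "(\<lambda>\<omega>. real (X u k \<omega>)) \<in> borel_measurable M" "(\<lambda>\<omega>. real (X v k \<omega>)) \<in> borel_measurable M"
    using u by (auto intro!: measurable_fun_X simp del: One_nat_def)
  have C0: "0 \<le> C" by (simp add: C_def)
  have bnd: "\<bar>a \<omega>\<bar> \<le> 1" "\<bar>d \<omega>\<bar> \<le> 1" "\<bar>a' \<omega>\<bar> \<le> C" "\<bar>d' \<omega>\<bar> \<le> C" for \<omega>
    unfolding a_def a'_def d_def d'_def C_def by (rule near_abs_le abs_near_mult_le)+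
  have prod_bnd: "\<bar>y * z\<bar> \<le> B * D" if "\<bar>y\<bar> \<le> B" "\<bar>z\<bar> \<le> D" for y z B D :: real
    unfolding abs_mult using that by (intro mult_mono) auto
  have X1: "\<bar>real (X u k \<omega>)\<bar> \<le> 1" "\<bar>real (X v k \<omega>)\<bar> \<le> 1" if "\<omega> \<in> space M" for \<omega>
    using X_values[OF u(1,4) that] X_values[OF u(2,4) that] by auto
  define t where "t = expectation (\<lambda>\<omega>. a' \<omega> * d' \<omega>)"
  have 1: "expectation (\<lambda>\<omega>. (a \<omega> * d \<omega>) * (real (X u k \<omega>) * real (X v k \<omega>))) = t"
  proof -
    have "expectation (\<lambda>\<omega>. (a \<omega> * d \<omega>) * (real (X u k \<omega>) * real (X v k \<omega>))) = expectation (\<lambda>\<omega>. (a \<omega> * d \<omega>) * (p u \<omega> * p v \<omega>))"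
      by (rule expectation_mult_X_X[OF u, where B = "1 * 1"]) (intro borel_measurable_times F prod_bnd bnd)+
    also have "\<dots> = t" by (simp add: t_def a_def d_def a'_def d'_def ac_simps)
    finally show ?thesis .
  qed
  have 2: "expectation (\<lambda>\<omega>. (a \<omega> * d' \<omega>) * real (X u k \<omega>)) = t"
  proof -
    have "expectation (\<lambda>\<omega>. (a \<omega> * d' \<omega>) * real (X u k \<omega>)) = expectation (\<lambda>\<omega>. (a \<omega> * d' \<omega>) * p u \<omega>)"
      by (rule expectation_mult_X[OF u(1,4), where B = "1 * C"]) (intro borel_measurable_times F prod_bnd bnd)+
    also have "\<dots> = t" by (simp add: t_def a_def d_def a'_def d'_def ac_simps)
    finally show ?thesis .
  qed
  have 3: "expectation (\<lambda>\<omega>. (a' \<omega> * d \<omega>) * real (X v k \<omega>)) = t"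
  proof -
    have "expectation (\<lambda>\<omega>. (a' \<omega> * d \<omega>) * real (X v k \<omega>)) = expectation (\<lambda>\<omega>. (a' \<omega> * d \<omega>) * p v \<omega>)"
      by (rule expectation_mult_X[OF u(2,4), where B = "C * 1"]) (intro borel_measurable_times F prod_bnd bnd)+
    also have "\<dots> = t" by (simp add: t_def a_def d_def a'_def d'_def ac_simps)
    finally show ?thesis .
  qed
  have i1: "integrable M (\<lambda>\<omega>. (a \<omega> * d \<omega>) * (real (X u k \<omega>) * real (X v k \<omega>)))"
    by (rule integrable_bounded[where B = "(1 * 1) * (1 * 1)"])
      (intro borel_measurable_times M x prod_bnd bnd X1; assumption)+
  have i2: "integrable M (\<lambda>\<omega>. (a \<omega> * d' \<omega>) * real (X u k \<omega>))"
    by (rule integrable_bounded[where B = "(1 * C) * 1"])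
      (intro borel_measurable_times M x prod_bnd bnd X1; assumption)+
  have i3: "integrable M (\<lambda>\<omega>. (a' \<omega> * d \<omega>) * real (X v k \<omega>))"
    by (rule integrable_bounded[where B = "(C * 1) * 1"])
      (intro borel_measurable_times M x prod_bnd bnd X1; assumption)+
  have i4: "integrable M (\<lambda>\<omega>. a' \<omega> * d' \<omega>)"
    by (rule integrable_bounded[where B = "C * C"])
      (intro borel_measurable_times M x prod_bnd bnd X1; assumption)+
  have "expectation (\<lambda>\<omega>. (near \<epsilon> (p u \<omega>) * (real (X u k \<omega>) - p u \<omega>)) * (near \<epsilon> (p v \<omega>) * (real (X v k \<omega>) - p v \<omega>))) =
    expectation (\<lambda>\<omega>. (a \<omega> * d \<omega>) * (real (X u k \<omega>) * real (X v k \<omega>)) - (a \<omega> * d' \<omega>) * real (X u k \<omega>)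
      - (a' \<omega> * d \<omega>) * real (X v k \<omega>) + a' \<omega> * d' \<omega>)"
    by (rule Bochner_Integration.integral_cong) (simp_all add: a_def d_def a'_def d'_def algebra_simps)
  also have "\<dots> = t - t - t + t"
    using i1 i2 i3 i4 by (simp add: 1 2 3 flip: t_def)
  finally show ?thesis by simp
qed

lemma expectation_near_orthogonal:
  assumes u: "u \<ge> 2" "v \<ge> 2" "u \<noteq> v"
    and q: "expectation (\<lambda>\<omega>. near \<epsilon> (p u \<omega>)) = q" "expectation (\<lambda>\<omega>. near \<epsilon> (p v \<omega>)) = q"
  shows "expectation (\<lambda>\<omega>. (near \<epsilon> (p u \<omega>) - q) * (near \<epsilon> (p v \<omega>) - q)) = 0"
proof -
  have "indep_vars (\<lambda>_. borel) (\<lambda>i \<omega>. near \<epsilon> (p i \<omega>) - q) {2..}"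
    by (rule indep_vars_compose2[OF p_indep]) simp
  then have ind: "indep_vars (\<lambda>_. borel) (\<lambda>i \<omega>. near \<epsilon> (p i \<omega>) - q) {u, v}"
    by (rule indep_vars_subset) (use u in auto)
  have int: "integrable M (\<lambda>\<omega>. near \<epsilon> (p i \<omega>))" if "i \<ge> 2" for i
    by (rule integrable_bounded[where B = 1]) (use that near_abs_le near_p_measurable in auto)
  have "expectation (\<lambda>\<omega>. \<Prod>i\<in>{u, v}. near \<epsilon> (p i \<omega>) - q) = (\<Prod>i\<in>{u, v}. expectation (\<lambda>\<omega>. near \<epsilon> (p i \<omega>) - q))"
    by (rule indep_vars_lebesgue_integral[OF _ ind]) (use u int in auto)
  then show ?thesis using u q int by (simp add: prob_space)
qed

text \<open>With \<open>L\<close> the expected number of close users, \<open>L\<close> times the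
  target splits into four errors: replacing the location of user 1 by that of \<open>u\<close>
  (\<open>D\<close>), replacing \<open>p u\<close> by \<open>p1\<close> (\<open>Q\<close>), the
  fluctuation of locations around their parameters (\<open>R2\<close>), and the fluctuation of the
  number of close users around \<open>L\<close> (\<open>R1\<close>). The first two are proportional
  to \<open>L\<close>, the last two are at most \<open>sqrt L\<close>; dividing by \<open>L\<close>
  gives the three terms of the bound.\<close>

lemma deviation_le:
  assumes n: "n \<ge> 2" and k: "k \<in> {1..m}"
    and A: "A \<in> sets (observation_space m n \<Otimes>\<^sub>M Pi\<^sub>M {1..n} (\<lambda>_. borel))"
    and p01: "\<And>v. v \<ge> 1 \<Longrightarrow> AE \<omega> in M. 0 < p v \<omega> \<and> p v \<omega> < 1"
    and \<kappa>: "0 < \<kappa>" "\<And>q. \<bar>q - p1\<bar> \<le> \<epsilon> \<Longrightarrow> \<kappa> \<le> q * (1 - q)" and \<epsilon>: "0 \<le> \<epsilon>"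
    and q: "0 < q" "\<And>u. u \<ge> 2 \<Longrightarrow> expectation (\<lambda>\<omega>. near \<epsilon> (p u \<omega>)) = q"
  shows "\<bar>expectation (\<lambda>\<omega>. (real (X 1 k \<omega>) - p1) * indicator A (observation X Perm m n \<omega>, p_upto n \<omega>))\<bar>
    \<le> 2 / sqrt (real (n - 1) * q) + sqrt (exp (2 * real m * \<epsilon>\<^sup>2 / \<kappa>) - 1) + \<epsilon>"
proof -
  define T where "T = sqrt (exp (2 * real m * \<epsilon>\<^sup>2 / \<kappa>) - 1)"
  define L where "L = real (n - 1) * q"
  define G where "G = (\<lambda>\<omega>. indicator A (observation X Perm m n \<omega>, p_upto n \<omega>) :: real)"
  define x where "x = (\<lambda>u \<omega>. real (X u k \<omega>))"
  define N where "N = (\<lambda>u \<omega>. near \<epsilon> (p u \<omega>))"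
  define Z1 where "Z1 = (\<lambda>u \<omega>. N u \<omega> - q)"
  define Z2 where "Z2 = (\<lambda>u \<omega>. N u \<omega> * (x u \<omega> - p u \<omega>))"
  have L: "0 < L" using n q by (simp add: L_def)
  have k1: "k \<ge> 1" using k by simp
  have inside: "0 < r \<and> r < 1" if "\<bar>r - p1\<bar> \<le> \<epsilon>" for r
  proof -
    have "0 < r * (1 - r)" using \<kappa>(1) \<kappa>(2)[OF that] by simp
    then show ?thesis by (auto simp: zero_less_mult_iff)
  qed
  have p1: "0 < p1" "p1 < 1" using inside[of p1] \<epsilon> by auto
  have Gm[measurable]: "G \<in> borel_measurable M"
    unfolding G_def
    by (rule measurable_compose[OF measurable_Pair[OF observation_measurable p_upto_measurable]
      borel_measurable_indicator[OF A]])
  have G01: "0 \<le> G \<omega>" "G \<omega> \<le> 1" for \<omega> by (auto simp: G_def indicator_def)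
  have xm[measurable]: "x u \<in> borel_measurable M" if "u \<ge> 1" for u
    unfolding x_def by (rule measurable_fun_X[OF that k1])
  have Nm[measurable]: "N u \<in> borel_measurable M" if "u \<ge> 1" for u
    unfolding N_def by (rule near_p_measurable[OF that])
  have pm[measurable]: "p u \<in> borel_measurable M" if "u \<ge> 1" for u
    by (rule p_measurable[OF that])
  have x01: "0 \<le> x u \<omega>" "x u \<omega> \<le> 1" if "u \<ge> 1" "\<omega> \<in> space M" for u \<omega>
    using X_values[OF that(1) k1 that(2)] by (auto simp: x_def)
  have N01: "N u \<omega> = 0 \<or> N u \<omega> = 1" for u \<omega> by (simp add: N_def near_def)
  have Nin: "0 < p u \<omega> \<and> p u \<omega> < 1 \<and> \<bar>p u \<omega> - p1\<bar> \<le> \<epsilon>" if "N u \<omega> \<noteq> 0" for u \<omega>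
    using that inside[of "p u \<omega>"] by (auto simp: N_def near_def split: if_splits)
  have intN: "integrable M (N u)" if "u \<ge> 1" for u
    by (rule integrable_bounded[where B = 1, OF Nm[OF that]]) (simp add: N_def near_def)
  have EN: "expectation (N u) = q" if "u \<ge> 2" for u using q(2)[OF that] by (simp add: N_def)
  have q1: "q \<le> 1"
  proof -
    have "expectation (N 2) \<le> expectation (\<lambda>_. 1)"
      by (intro integral_mono intN) (simp_all add: N_def near_def)
    then show ?thesis using EN[of 2] by (simp add: prob_space)
  qed
  have Z1m: "Z1 u \<in> borel_measurable M" if "u \<in> {2..n}" for u
    using that unfolding Z1_def by (intro borel_measurable_diff Nm) auto
  have Z2m: "Z2 u \<in> borel_measurable M" if "u \<in> {2..n}" for u
    using that unfolding Z2_def by (intro borel_measurable_times borel_measurable_diff Nm xm pm) auto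
  have Z1b: "\<bar>Z1 u \<omega>\<bar> \<le> 1" for u \<omega> using N01[of u \<omega>] q(1) q1 by (auto simp: Z1_def)
  have Z2b: "\<bar>Z2 u \<omega>\<bar> \<le> 1" if "u \<in> {2..n}" "\<omega> \<in> space M" for u \<omega>
    using N01[of u \<omega>] Nin[of u \<omega>] x01[of u \<omega>] that by (auto simp: Z2_def abs_le_iff)
  have card: "card {2..n} = n - 1" by simp
  have S1: "expectation (\<lambda>\<omega>. \<bar>\<Sum>u\<in>{2..n}. Z1 u \<omega>\<bar>) \<le> sqrt L"
    unfolding L_def card[symmetric]
  proof (rule expectation_abs_sum_orthogonal_le)
    show "expectation (\<lambda>\<omega>. Z1 u \<omega> * Z1 v \<omega>) = 0" if "u \<in> {2..n}" "v \<in> {2..n}" "u \<noteq> v" for u v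
      unfolding Z1_def N_def using that q(2) by (intro expectation_near_orthogonal) auto
    show "expectation (\<lambda>\<omega>. (Z1 u \<omega>)\<^sup>2) \<le> q" if "u \<in> {2..n}" for u
    proof -
      \<comment> \<open>As \<open>N\<close> only takes the values 0 and 1, the square is affine in
        \<open>N\<close>, and its mean is the Bernoulli variance \<open>q * (1 - q)\<close>.\<close>
      have sq: "(Z1 u \<omega>)\<^sup>2 = (1 - 2 * q) * N u \<omega> + q\<^sup>2" for \<omega>
        using N01[of u \<omega>] by (auto simp: Z1_def power2_eq_square algebra_simps)
      have "expectation (\<lambda>\<omega>. (Z1 u \<omega>)\<^sup>2) = (1 - 2 * q) * q + q\<^sup>2"
        unfolding sq using that EN[of u] intN[of u] by (simp add: prob_space)
      also have "\<dots> \<le> q" by (simp add: power2_eq_square algebra_simps)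
      finally show ?thesis .
    qed
  qed (use Z1m Z1b in auto)
  have S2: "expectation (\<lambda>\<omega>. \<bar>\<Sum>u\<in>{2..n}. Z2 u \<omega>\<bar>) \<le> sqrt L"
    unfolding L_def card[symmetric]
  proof (rule expectation_abs_sum_orthogonal_le)
    show "expectation (\<lambda>\<omega>. Z2 u \<omega> * Z2 v \<omega>) = 0" if "u \<in> {2..n}" "v \<in> {2..n}" "u \<noteq> v" for u v
      unfolding Z2_def N_def x_def using that k1 by (intro expectation_centered_orthogonal) auto
    show "expectation (\<lambda>\<omega>. (Z2 u \<omega>)\<^sup>2) \<le> q" if u: "u \<in> {2..n}" for u
    proof -
      \<comment> \<open>The factor \<open>N\<close> survives the squaring and the centered location
        is at most 1 in absolute value, which gives the second moment bound
        \<open>q\<close>.\<close>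
      have sq: "(Z2 u \<omega>)\<^sup>2 \<le> N u \<omega>" if "\<omega> \<in> space M" for \<omega>
        using N01[of u \<omega>] Z2b[OF u that] by (auto simp: Z2_def abs_square_le_1)
      have "expectation (\<lambda>\<omega>. (Z2 u \<omega>)\<^sup>2) \<le> expectation (N u)"
      proof (rule integral_mono)
        show "integrable M (\<lambda>\<omega>. (Z2 u \<omega>)\<^sup>2)"
          by (rule integrable_bounded[where B = 1])
            (use Z2m[OF u] Z2b[OF u] in \<open>auto simp: abs_square_le_1\<close>)
      qed (use sq intN u in auto)
      then show ?thesis using EN[of u] u by simp
    qed
  qed (use Z2m Z2b in auto)
  have iS1: "integrable M (\<lambda>\<omega>. \<Sum>u\<in>{2..n}. Z1 u \<omega>)"
    by (intro Bochner_Integration.integrable_sum integrable_bounded[where B = 1] Z1m Z1b)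
  have iS2: "integrable M (\<lambda>\<omega>. \<Sum>u\<in>{2..n}. Z2 u \<omega>)"
    by (intro Bochner_Integration.integrable_sum integrable_bounded[where B = 1] Z2m Z2b)
  \<comment> \<open>In both remainders the sum is multiplied by a factor of absolute value at most
    1, and only absolute values are estimated; the event behind \<open>G\<close> may therefore
    depend on the sum in any way.\<close>
  define R1 where "R1 = (\<lambda>\<omega>. (\<Sum>u\<in>{2..n}. Z1 u \<omega>) * ((x 1 \<omega> - p1) * G \<omega>))"
  define R2 where "R2 = (\<lambda>\<omega>. (\<Sum>u\<in>{2..n}. Z2 u \<omega>) * G \<omega>)"
  define D where "D = (\<lambda>u \<omega>. N u \<omega> * x 1 \<omega> * G \<omega> - N u \<omega> * x u \<omega> * G \<omega>)"
  define Q where "Q = (\<lambda>u \<omega>. N u \<omega> * (p u \<omega> - p1) * G \<omega>)"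
  have R1m: "R1 \<in> borel_measurable M"
    unfolding R1_def using Z1m by (intro borel_measurable_times borel_measurable_sum borel_measurable_diff Gm xm) auto
  have R2m: "R2 \<in> borel_measurable M"
    unfolding R2_def using Z2m by (intro borel_measurable_times borel_measurable_sum Gm) auto
  have R1b: "\<bar>R1 \<omega>\<bar> \<le> \<bar>\<Sum>u\<in>{2..n}. Z1 u \<omega>\<bar>" if "\<omega> \<in> space M" for \<omega>
  proof -
    have "\<bar>(x 1 \<omega> - p1) * G \<omega>\<bar> \<le> 1 * 1"
      unfolding abs_mult using x01[of 1 \<omega>] that p1 G01[of \<omega>] by (intro mult_mono) auto
    then show ?thesis unfolding R1_def abs_mult[of "sum _ _"] by (intro mult_left_le) auto
  qed
  have R2b: "\<bar>R2 \<omega>\<bar> \<le> \<bar>\<Sum>u\<in>{2..n}. Z2 u \<omega>\<bar>" for \<omega>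
    unfolding R2_def abs_mult using G01[of \<omega>] by (intro mult_left_le) auto
  have iR1: "integrable M R1"
    by (rule Bochner_Integration.integrable_bound[OF iS1 R1m]) (use R1b in \<open>auto intro!: AE_I2\<close>)
  have iR2: "integrable M R2"
    by (rule Bochner_Integration.integrable_bound[OF iS2 R2m]) (use R2b in \<open>auto intro!: AE_I2\<close>)
  have iNx: "integrable M (\<lambda>\<omega>. N u \<omega> * x v \<omega> * G \<omega>)" if "u \<ge> 1" "v \<ge> 1" for u v
  proof (rule integrable_bounded[where B = "1 * 1 * 1"])
    show "(\<lambda>\<omega>. N u \<omega> * x v \<omega> * G \<omega>) \<in> borel_measurable M" using that by measurable
    show "\<bar>N u \<omega> * x v \<omega> * G \<omega>\<bar> \<le> 1 * 1 * 1" if "\<omega> \<in> space M" for \<omega>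
      unfolding abs_mult using N01[of u \<omega>] x01[of v \<omega>] G01[of \<omega>] that \<open>v \<ge> 1\<close> by (intro mult_mono) auto
  qed
  have iD: "integrable M (D u)" if "u \<in> {2..n}" for u
    unfolding D_def using that by (intro Bochner_Integration.integrable_diff iNx) auto
  have Qb: "\<bar>Q u \<omega>\<bar> \<le> \<epsilon> * N u \<omega>" for u \<omega>
  proof (cases "N u \<omega> = 0")
    case False
    then have "N u \<omega> = 1" using N01[of u \<omega>] by simp
    moreover have "\<bar>p u \<omega> - p1\<bar> * \<bar>G \<omega>\<bar> \<le> \<epsilon> * 1"
      using Nin[OF False] G01[of \<omega>] \<epsilon> by (intro mult_mono) auto
    ultimately show ?thesis by (simp add: Q_def abs_mult)
  qed (simp add: Q_def)
  have iQ: "integrable M (Q u)" if "u \<in> {2..n}" for u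
  proof (rule Bochner_Integration.integrable_bound[of _ "\<lambda>\<omega>. \<epsilon> * N u \<omega>"])
    show "integrable M (\<lambda>\<omega>. \<epsilon> * N u \<omega>)" using intN[of u] that by simp
    show "Q u \<in> borel_measurable M" 
      unfolding Q_def using that by (intro borel_measurable_times borel_measurable_diff Nm pm Gm) auto
    show "AE \<omega> in M. norm (Q u \<omega>) \<le> norm (\<epsilon> * N u \<omega>)"
      using Qb[of u] by (intro AE_I2) (metis abs_ge_self order.trans real_norm_def)
  qed
  \<comment> \<open>For each user, x_1 - p1 telescopes into (x_1 - x_u) + (p_u - p1) + (x_u - p_u).
    Weighting by \<open>N u\<close> and summing produces the random number of close users in front
    of x_1 - p1; \<open>R1\<close> corrects it to \<open>L\<close>.\<close>
  have decomp: "L * ((x 1 \<omega> - p1) * G \<omega>) = (\<Sum>u\<in>{2..n}. D u \<omega>) + (\<Sum>u\<in>{2..n}. Q u \<omega>) + R2 \<omega> - R1 \<omega>" for \<omega>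
  proof -
    have "R1 \<omega> = (\<Sum>u\<in>{2..n}. N u \<omega> * ((x 1 \<omega> - p1) * G \<omega>)) - L * ((x 1 \<omega> - p1) * G \<omega>)"
      unfolding R1_def Z1_def sum_subtractf L_def by (simp add: left_diff_distrib sum_distrib_right)
    moreover have "(\<Sum>u\<in>{2..n}. N u \<omega> * ((x 1 \<omega> - p1) * G \<omega>)) = (\<Sum>u\<in>{2..n}. D u \<omega>) + (\<Sum>u\<in>{2..n}. Q u \<omega>) + R2 \<omega>"
      unfolding R2_def sum_distrib_right sum.distrib[symmetric]
      by (intro sum.cong refl) (simp add: D_def Q_def Z2_def algebra_simps)
    ultimately show ?thesis by simp
  qed
  have "L * expectation (\<lambda>\<omega>. (x 1 \<omega> - p1) * G \<omega>) =
      expectation (\<lambda>\<omega>. (\<Sum>u\<in>{2..n}. D u \<omega>) + (\<Sum>u\<in>{2..n}. Q u \<omega>) + R2 \<omega> - R1 \<omega>)"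
    by (simp flip: decomp)
  also have "\<dots> = (\<Sum>u\<in>{2..n}. expectation (D u)) + (\<Sum>u\<in>{2..n}. expectation (Q u)) + expectation R2 - expectation R1"
  proof -
    have iDs: "integrable M (\<lambda>\<omega>. \<Sum>u\<in>{2..n}. D u \<omega>)" by (intro Bochner_Integration.integrable_sum iD)
    have iQs: "integrable M (\<lambda>\<omega>. \<Sum>u\<in>{2..n}. Q u \<omega>)" by (intro Bochner_Integration.integrable_sum iQ)
    have "expectation (\<lambda>\<omega>. \<Sum>u\<in>{2..n}. D u \<omega>) = (\<Sum>u\<in>{2..n}. expectation (D u))"
      by (rule Bochner_Integration.integral_sum) (rule iD)
    moreover have "expectation (\<lambda>\<omega>. \<Sum>u\<in>{2..n}. Q u \<omega>) = (\<Sum>u\<in>{2..n}. expectation (Q u))"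
      by (rule Bochner_Integration.integral_sum) (rule iQ)
    ultimately show ?thesis using iDs iQs iR1 iR2 by simp
  qed
  finally have eq: "L * expectation (\<lambda>\<omega>. (x 1 \<omega> - p1) * G \<omega>) =
    (\<Sum>u\<in>{2..n}. expectation (D u)) + (\<Sum>u\<in>{2..n}. expectation (Q u)) + expectation R2 - expectation R1" .
  have bD: "\<bar>\<Sum>u\<in>{2..n}. expectation (D u)\<bar> \<le> T * L"
  proof -
    have "\<bar>expectation (D u)\<bar> \<le> T * q" if u: "u \<in> {2..n}" for u
    proof -
      have "expectation (D u) = expectation (\<lambda>\<omega>. N u \<omega> * x 1 \<omega> * G \<omega>) - expectation (\<lambda>\<omega>. N u \<omega> * x u \<omega> * G \<omega>)"
        unfolding D_def using u by (intro Bochner_Integration.integral_diff iNx) auto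
      also have "\<bar>\<dots>\<bar> \<le> T * expectation (\<lambda>\<omega>. near \<epsilon> (p u \<omega>))"
        unfolding N_def x_def G_def T_def by (rule swap_deviation_le[OF u k A p01 \<kappa> \<epsilon>])
      finally show ?thesis using q(2)[of u] u by simp
    qed
    then have "(\<Sum>u\<in>{2..n}. \<bar>expectation (D u)\<bar>) \<le> real (card {2..n}) * (T * q)"
      by (rule sum_bounded_above)
    then show ?thesis unfolding L_def card by (intro order.trans[OF sum_abs]) (simp add: ac_simps)
  qed
  have bQ: "\<bar>\<Sum>u\<in>{2..n}. expectation (Q u)\<bar> \<le> \<epsilon> * L"
  proof -
    have "\<bar>expectation (Q u)\<bar> \<le> \<epsilon> * q" if u: "u \<in> {2..n}" for u
    proof -
      have "\<bar>expectation (Q u)\<bar> \<le> expectation (\<lambda>\<omega>. \<bar>Q u \<omega>\<bar>)" by (rule integral_abs_bound)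
      also have "\<dots> \<le> expectation (\<lambda>\<omega>. \<epsilon> * N u \<omega>)"
        using iQ[OF u] intN[of u] u Qb by (intro integral_mono) auto
      also have "\<dots> = \<epsilon> * q" using EN[of u] u by simp
      finally show ?thesis .
    qed
    then have "(\<Sum>u\<in>{2..n}. \<bar>expectation (Q u)\<bar>) \<le> real (card {2..n}) * (\<epsilon> * q)"
      by (rule sum_bounded_above)
    then show ?thesis unfolding L_def card by (intro order.trans[OF sum_abs]) (simp add: ac_simps)
  qed
  have bR1: "\<bar>expectation R1\<bar> \<le> sqrt L"
  proof -
    have "\<bar>expectation R1\<bar> \<le> expectation (\<lambda>\<omega>. \<bar>R1 \<omega>\<bar>)" by (rule integral_abs_bound)
    also have "\<dots> \<le> expectation (\<lambda>\<omega>. \<bar>\<Sum>u\<in>{2..n}. Z1 u \<omega>\<bar>)"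
      by (rule integral_mono[OF integrable_abs[OF iR1] integrable_abs[OF iS1] R1b])
    finally show ?thesis using S1 by simp
  qed
  have bR2: "\<bar>expectation R2\<bar> \<le> sqrt L"
  proof -
    have "\<bar>expectation R2\<bar> \<le> expectation (\<lambda>\<omega>. \<bar>R2 \<omega>\<bar>)" by (rule integral_abs_bound)
    also have "\<dots> \<le> expectation (\<lambda>\<omega>. \<bar>\<Sum>u\<in>{2..n}. Z2 u \<omega>\<bar>)"
      by (rule integral_mono[OF integrable_abs[OF iR2] integrable_abs[OF iS2] R2b])
    finally show ?thesis using S2 by simp
  qed
  have "L * \<bar>expectation (\<lambda>\<omega>. (x 1 \<omega> - p1) * G \<omega>)\<bar> = \<bar>L * expectation (\<lambda>\<omega>. (x 1 \<omega> - p1) * G \<omega>)\<bar>"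
    using L by (simp add: abs_mult)
  also have "\<dots> \<le> T * L + \<epsilon> * L + sqrt L + sqrt L"
    unfolding eq using bD bQ bR1 bR2 by linarith
  also have "\<dots> = L * (2 / sqrt L + T + \<epsilon>)"
    using L by (simp add: field_simps)
  finally show ?thesis using L unfolding mult_le_cancel_left_pos[OF L] by (simp add: x_def G_def T_def L_def)
qed

end

lemma filterlim_powr_at_top:
  fixes a :: real
  assumes "0 < a"
  shows "filterlim (\<lambda>x. x powr a) at_top at_top"
proof -
  have "filterlim (\<lambda>x. exp (a * ln x)) at_top at_top"
    using assms by (intro filterlim_compose[OF exp_at_top]
      filterlim_tendsto_pos_mult_at_top[OF tendsto_const] ln_at_top)
  moreover have "eventually (\<lambda>x. exp (a * ln x) = x powr a) at_top"
    using eventually_gt_at_top[of 0] by eventually_elim (simp add: powr_def)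
  ultimately show ?thesis by (rule filterlim_mono_eventually[OF _ order_refl order_refl])
qed

section \<open>From deviations of events to conditional mutual information\<close>

context anonymized_two_state_model
begin

lemma prob_X1:
  assumes "k \<ge> 1"
  shows "\<P>(\<omega> in M. X 1 k \<omega> = 1) = p1" "\<P>(\<omega> in M. X 1 k \<omega> = 0) = 1 - p1"
proof -
  have "\<P>(\<omega> in M. X 1 k \<omega> = 1) = expectation (\<lambda>\<omega>. 1 * real (X 1 k \<omega>))"
  proof -
    have "expectation (\<lambda>\<omega>. 1 * real (X 1 k \<omega>)) = expectation (indicator {\<omega> \<in> space M. X 1 k \<omega> = 1})"
      using X_values[OF _ assms] by (intro Bochner_Integration.integral_cong) (force simp: indicator_def)+
    then show ?thesis using events_X[OF _ assms, of 1 1] by simp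
  qed
  also have "\<dots> = expectation (\<lambda>\<omega>. 1 * p 1 \<omega>)"
    by (rule expectation_mult_X[where B = 1]) (use assms in auto)
  also have "\<dots> = expectation (\<lambda>_. p1)"
    using p_first by (intro Bochner_Integration.integral_cong) auto
  finally show *: "\<P>(\<omega> in M. X 1 k \<omega> = 1) = p1" by (simp add: prob_space)
  have "{\<omega> \<in> space M. X 1 k \<omega> = 0} = space M - {\<omega> \<in> space M. X 1 k \<omega> = 1}"
  proof (intro set_eqI)
    fix \<omega>
    show "\<omega> \<in> {\<omega> \<in> space M. X 1 k \<omega> = 0} \<longleftrightarrow> \<omega> \<in> space M - {\<omega> \<in> space M. X 1 k \<omega> = 1}"
      using X_values[OF order_refl assms, of \<omega>] by auto
  qed
  then show "\<P>(\<omega> in M. X 1 k \<omega> = 0) = 1 - p1"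
    using * prob_compl[OF events_X[OF order_refl assms, of 1]] by simp
qed

text \<open>Identifies the deviation from independence with the centered expectation estimated in
  \<open>deviation_le\<close>; it works because \<open>p1\<close> is the unconditional probability
  that user 1 is at location 1.\<close>

lemma prob_X1_joint:
  assumes k: "k \<ge> 1" and W: "W \<in> M \<rightarrow>\<^sub>M T" and A: "A \<in> sets T"
  shows "\<P>(\<omega> in M. X 1 k \<omega> = 1 \<and> W \<omega> \<in> A) - \<P>(\<omega> in M. X 1 k \<omega> = 1) * \<P>(\<omega> in M. W \<omega> \<in> A) =
    expectation (\<lambda>\<omega>. (real (X 1 k \<omega>) - p1) * indicator A (W \<omega>))"
proof -
  have evW: "{\<omega> \<in> space M. W \<omega> \<in> A} \<in> events"
    using measurable_sets[OF W A] by (simp add: vimage_def Int_def conj_commute)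
  have evXW: "{\<omega> \<in> space M. X 1 k \<omega> = 1 \<and> W \<omega> \<in> A} \<in> events"
    by (rule sets.sets_Collect_conj[OF evW events_X[OF order_refl k]])
  have "expectation (\<lambda>\<omega>. (real (X 1 k \<omega>) - p1) * indicator A (W \<omega>)) =
      expectation (\<lambda>\<omega>. indicator {\<omega> \<in> space M. X 1 k \<omega> = 1 \<and> W \<omega> \<in> A} \<omega> - p1 * indicator {\<omega> \<in> space M. W \<omega> \<in> A} \<omega>)"
  proof (rule Bochner_Integration.integral_cong[OF refl])
    fix \<omega> assume "\<omega> \<in> space M"
    then show "(real (X 1 k \<omega>) - p1) * indicator A (W \<omega>) =
       indicator {\<omega> \<in> space M. X 1 k \<omega> = 1 \<and> W \<omega> \<in> A} \<omega> - p1 * indicator {\<omega> \<in> space M. W \<omega> \<in> A} \<omega>"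
      using X_values[OF order_refl k, of \<omega>] by (auto simp: indicator_def)
  qed
  also have "\<dots> = \<P>(\<omega> in M. X 1 k \<omega> = 1 \<and> W \<omega> \<in> A) - p1 * \<P>(\<omega> in M. W \<omega> \<in> A)"
    using evW evXW by (subst Bochner_Integration.integral_diff)
      (auto intro!: integrable_real_indicator simp: emeasure_eq_measure)
  finally show ?thesis using prob_X1[OF k] by simp
qed

text \<open>The conditional information is the information about (Y, P) minus the information about
  P. The parameter of user 1 is a constant, so conditioning on P leaves the law of its location
  unchanged and the subtracted term vanishes.\<close>

lemma conditional_mutual_information_bounds:
  assumes b: "b > 1" and k: "k \<ge> 1" and \<kappa>: "0 < \<kappa>" "\<kappa> \<le> p1" "\<kappa> \<le> 1 - p1"
    and dev: "\<And>A. A \<in> sets (observation_space m n \<Otimes>\<^sub>M Pi\<^sub>M {1..n} (\<lambda>_. borel)) \<Longrightarrow>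
      \<bar>expectation (\<lambda>\<omega>. (real (X 1 k \<omega>) - p1) * indicator A (observation X Perm m n \<omega>, p_upto n \<omega>))\<bar> \<le> \<eta>"
  shows "\<bar>conditional_mutual_information b (count_space {0, 1}) (observation_space m n) (Pi\<^sub>M {1..n} (\<lambda>_. borel))
      (X 1 k) (observation X Perm m n) (p_upto n)\<bar> \<le> 4 * \<eta> / (\<kappa> * ln b)"
proof -
  interpret information_space M b by unfold_locales (rule b)
  let ?O = "observation_space m n \<Otimes>\<^sub>M Pi\<^sub>M {1..n} (\<lambda>_. borel) :: ((nat \<times> nat \<Rightarrow> nat) \<times> (nat \<Rightarrow> real)) measure"
  have Xm: "X 1 k \<in> M \<rightarrow>\<^sub>M count_space {0, 1}" by (rule X_measurable[OF order_refl k])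
  have \<kappa>P: "\<kappa> \<le> \<P>(\<omega> in M. X 1 k \<omega> = i)" if "i \<in> {0, 1}" for i
    using that prob_X1[OF k] \<kappa> by auto
  have W: "(\<lambda>\<omega>. (observation X Perm m n \<omega>, p_upto n \<omega>)) \<in> M \<rightarrow>\<^sub>M ?O"
    by (rule measurable_Pair[OF observation_measurable p_upto_measurable])
  have 1: "\<bar>\<P>(\<omega> in M. X 1 k \<omega> = 1 \<and> (observation X Perm m n \<omega>, p_upto n \<omega>) \<in> A) -
      \<P>(\<omega> in M. X 1 k \<omega> = 1) * \<P>(\<omega> in M. (observation X Perm m n \<omega>, p_upto n \<omega>) \<in> A)\<bar> \<le> \<eta>"
    if "A \<in> sets ?O" for A
    unfolding prob_X1_joint[OF k W that] by (rule dev[OF that])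
  have 0: "\<bar>\<P>(\<omega> in M. X 1 k \<omega> = 1 \<and> p_upto n \<omega> \<in> A) -
      \<P>(\<omega> in M. X 1 k \<omega> = 1) * \<P>(\<omega> in M. p_upto n \<omega> \<in> A)\<bar> \<le> 0"
    if A: "A \<in> sets (Pi\<^sub>M {1..n} (\<lambda>_. borel))" for A
  proof -
    have hm: "(\<lambda>\<omega>. indicator A (p_upto n \<omega>) :: real) \<in> borel_measurable p_algebra"
      by (rule measurable_compose[OF p_upto_measurable_p_algebra borel_measurable_indicator[OF A]])
    have hm': "(\<lambda>\<omega>. indicator A (p_upto n \<omega>) :: real) \<in> borel_measurable M"
      by (rule measurable_from_subalg[OF subalgebra_p hm])
    have i1: "integrable M (\<lambda>\<omega>. indicator A (p_upto n \<omega>) * real (X 1 k \<omega>))"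
    proof (rule integrable_bounded[where B = 1])
      show "(\<lambda>\<omega>. indicator A (p_upto n \<omega>) * real (X 1 k \<omega>)) \<in> borel_measurable M"
        by (intro borel_measurable_times hm' measurable_fun_X k) simp
      show "\<bar>indicator A (p_upto n \<omega>) * real (X 1 k \<omega>)\<bar> \<le> 1" if "\<omega> \<in> space M" for \<omega>
        using X_values[OF order_refl k that] by (auto simp: indicator_def)
    qed
    have i2: "integrable M (\<lambda>\<omega>. indicator A (p_upto n \<omega>) * p1)"
      by (intro integrable_mult_left integrable_bounded[where B = 1] hm') simp
    have "expectation (\<lambda>\<omega>. (real (X 1 k \<omega>) - p1) * indicator A (p_upto n \<omega>)) =
        expectation (\<lambda>\<omega>. indicator A (p_upto n \<omega>) * real (X 1 k \<omega>) - indicator A (p_upto n \<omega>) * p1)"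
      by (simp add: algebra_simps)
    also have "\<dots> = expectation (\<lambda>\<omega>. indicator A (p_upto n \<omega>) * real (X 1 k \<omega>)) - expectation (\<lambda>\<omega>. indicator A (p_upto n \<omega>) * p1)"
      by (rule Bochner_Integration.integral_diff[OF i1 i2])
    also have "expectation (\<lambda>\<omega>. indicator A (p_upto n \<omega>) * real (X 1 k \<omega>)) = expectation (\<lambda>\<omega>. indicator A (p_upto n \<omega>) * p 1 \<omega>)"
      by (rule expectation_mult_X[OF order_refl k hm, where B = 1]) simp
    also have "\<dots> = expectation (\<lambda>\<omega>. indicator A (p_upto n \<omega>) * p1)"
      using p_first by (intro Bochner_Integration.integral_cong) auto
    finally show ?thesis unfolding prob_X1_joint[OF k p_upto_measurable A] by simp
  qed
  note bounds1 = mutual_information_binary_bounds[OF Xm W \<kappa>(1) \<kappa>P 1]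
  \<comment> \<open>With \<open>\<eta>\<close> equal to 0, the lower and upper bounds together force
    the information about the parameters to be exactly 0.\<close>
  note bounds0 = mutual_information_binary_bounds[OF Xm p_upto_measurable \<kappa>(1) \<kappa>P 0]
  show ?thesis
    unfolding conditional_mutual_information_def using bounds1 bounds0 by simp
qed

section \<open>The density of the parameters near \<open>p1\<close>\<close>

lemma AE_p_in_unit_interval:
  assumes "0 < p1" "p1 < 1" and f: "\<And>x. x \<notin> {0<..<1} \<Longrightarrow> f x = 0" and u: "u \<ge> 1"
  shows "AE \<omega> in M. 0 < p u \<omega> \<and> p u \<omega> < 1"
proof (cases "u = 1")
  case True
  then show ?thesis using p_first assms(1,2) by (intro AE_I2) simp
next
  case False
  then have u2: "u \<ge> 2" using u by simp
  have "emeasure M (p u -` (- {0<..<1}) \<inter> space M) = (\<integral>\<^sup>+x. ennreal (f x) * indicator (- {0<..<1}) x \<partial>lborel)"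
    by (rule distributed_emeasure[OF p_density[OF u2]]) simp
  also have "\<dots> = (\<integral>\<^sup>+x. 0 \<partial>(lborel :: real measure))"
  proof (rule nn_integral_cong)
    show "ennreal (f x) * indicator (- {0<..<1}) x = 0" for x
      using f[of x] by (cases "x \<in> {0<..<1}") simp_all
  qed
  finally have "p u -` (- {0<..<1}) \<inter> space M \<in> null_sets M"
    using measurable_sets[OF p_measurable[OF u], of "- {0<..<1}"] by (auto simp: null_sets_def)
  then show ?thesis by (rule AE_I') auto
qed

text \<open>The right side does not mention \<open>u\<close>: all users from 2 on are close to user
  1 with one common probability, the \<open>q\<close> of \<open>deviation_le\<close>.\<close>

lemma expectation_near:
  assumes u: "u \<ge> 2"
  shows "expectation (\<lambda>\<omega>. near \<epsilon> (p u \<omega>)) =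
    enn2real (\<integral>\<^sup>+x. ennreal (f x) * indicator {p1 - \<epsilon>..p1 + \<epsilon>} x \<partial>lborel)"
proof -
  have pm: "p u \<in> borel_measurable M" using u by (intro p_measurable) simp
  have ev: "p u -` {p1 - \<epsilon>..p1 + \<epsilon>} \<inter> space M \<in> events"
    by (rule measurable_sets[OF pm]) simp
  have "expectation (\<lambda>\<omega>. near \<epsilon> (p u \<omega>)) = expectation (indicator (p u -` {p1 - \<epsilon>..p1 + \<epsilon>} \<inter> space M))"
    by (intro Bochner_Integration.integral_cong) (auto simp: near_def indicator_def abs_le_iff)
  also have "\<dots> = enn2real (emeasure M (p u -` {p1 - \<epsilon>..p1 + \<epsilon>} \<inter> space M))"
    using ev by (simp add: measure_def)
  also have "emeasure M (p u -` {p1 - \<epsilon>..p1 + \<epsilon>} \<inter> space M) =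
      (\<integral>\<^sup>+x. ennreal (f x) * indicator {p1 - \<epsilon>..p1 + \<epsilon>} x \<partial>lborel)"
    by (rule distributed_emeasure[OF p_density[OF u]]) simp
  finally show ?thesis .
qed

lemma expectation_near_ge:
  assumes u: "u \<ge> 2" and \<epsilon>: "0 \<le> \<epsilon>" "{p1 - \<epsilon>..p1 + \<epsilon>} \<subseteq> {0<..<1}"
    and f: "\<And>x. x \<in> {0<..<1} \<Longrightarrow> \<delta> \<le> f x" and \<delta>: "0 \<le> \<delta>"
  shows "2 * \<delta> * \<epsilon> \<le> expectation (\<lambda>\<omega>. near \<epsilon> (p u \<omega>))"
proof -
  have fin: "(\<integral>\<^sup>+x. ennreal (f x) * indicator {p1 - \<epsilon>..p1 + \<epsilon>} x \<partial>lborel) < \<infinity>"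
    using distributed_emeasure[OF p_density[OF u], of "{p1 - \<epsilon>..p1 + \<epsilon>}", symmetric]
    by (simp add: emeasure_eq_measure)
  have "ennreal (2 * \<delta> * \<epsilon>) = (\<integral>\<^sup>+x. ennreal \<delta> * indicator {p1 - \<epsilon>..p1 + \<epsilon>} x \<partial>lborel)"
    using \<epsilon>(1) \<delta> by (simp add: nn_integral_cmult_indicator algebra_simps flip: ennreal_mult)
  also have "\<dots> \<le> (\<integral>\<^sup>+x. ennreal (f x) * indicator {p1 - \<epsilon>..p1 + \<epsilon>} x \<partial>lborel)"
    using f \<epsilon>(2) by (intro nn_integral_mono) (auto simp: indicator_def intro!: ennreal_leI)
  finally have "enn2real (ennreal (2 * \<delta> * \<epsilon>)) \<le>
      enn2real (\<integral>\<^sup>+x. ennreal (f x) * indicator {p1 - \<epsilon>..p1 + \<epsilon>} x \<partial>lborel)"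
    using fin by (intro enn2real_mono) auto
  then show ?thesis unfolding expectation_near[OF u] using \<epsilon>(1) \<delta> by simp
qed

end

theorem theorem1:
  fixes M :: "'a measure"
    and p :: "nat \<Rightarrow> 'a \<Rightarrow> real"
    and X :: "nat \<Rightarrow> nat \<Rightarrow> 'a \<Rightarrow> nat"
    and Perm :: "nat \<Rightarrow> 'a \<Rightarrow> (nat \<Rightarrow> nat)"
    and f :: "real \<Rightarrow> real"
    and p1 c \<alpha> \<delta>1 \<delta>2 b :: real
    and m :: "nat \<Rightarrow> nat"
  assumes model: "anonymized_two_state_model M p X Perm p1 f"
    and "b > 1"
    and "c > 0"
    and "0 < \<alpha>" and "\<alpha> < 1"
    and m: "\<And>n. m n = nat \<lfloor>c * real n powr (2 - \<alpha>)\<rfloor>"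
    and "p1 \<in> {0<..<1}"
    and "continuous_on {0<..<1} f"
    and "0 < \<delta>1" and "\<delta>1 < \<delta>2"
    and "\<And>x. x \<in> {0<..<1} \<Longrightarrow> \<delta>1 < f x \<and> f x < \<delta>2"
    and "\<And>x. x \<notin> {0<..<1} \<Longrightarrow> f x = 0"
  shows "\<forall>k\<ge>1.
    (\<lambda>n. prob_space.conditional_mutual_information M b
           (count_space {0, 1}) (observation_space (m n) n) (Pi\<^sub>M {1..n} (\<lambda>_. borel))
           (X 1 k) (observation X Perm (m n) n) (\<lambda>\<omega>. \<lambda>u\<in>{1..n}. p u \<omega>))
      \<longlonglongrightarrow> 0"
proof (intro allI impI)
  fix k :: nat assume k: "k \<ge> 1"
  interpret anonymized_two_state_model M p X Perm p1 f by (rule model)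
  \<comment> \<open>With this exponent \<open>real n * \<epsilon> n\<close> equals
    \<open>real n powr \<beta>\<close>, the growth rate of the number of close users.\<close>
  define \<beta> where "\<beta> = \<alpha> / 4"
  have \<beta>: "0 < \<beta>" "\<beta> < 1" using assms(4,5) by (auto simp: \<beta>_def)
  define r where "r = min p1 (1 - p1) / 2"
  have r: "0 < r" "2 * r \<le> p1" "2 * r \<le> 1 - p1" using assms(7) by (auto simp: r_def)
  \<comment> \<open>Any parameter within \<open>r\<close> of \<open>p1\<close> keeps distance at
    least \<open>r\<close> from 0 and 1, so its Bernoulli variance is at least \<open>r * r\<close>.
    The same constant also bounds the two probabilities of user 1 from below.\<close>
  define \<kappa> where "\<kappa> = r * r"
  have \<kappa>: "0 < \<kappa>" "\<kappa> \<le> p1" "\<kappa> \<le> 1 - p1"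
  proof -
    have "\<kappa> \<le> r" unfolding \<kappa>_def using r by (intro mult_left_le) auto
    moreover have "0 < \<kappa>" unfolding \<kappa>_def using r by simp
    ultimately show "0 < \<kappa>" "\<kappa> \<le> p1" "\<kappa> \<le> 1 - p1" using r by linarith+
  qed
  define \<epsilon> where "\<epsilon> = (\<lambda>n::nat. real n powr (\<beta> - 1))"
  \<comment> \<open>The bound of \<open>deviation_le\<close> with its two implicit quantities
    replaced by explicit powers of \<open>n\<close>: the expected number of close users by a lower
    bound, and \<open>m n\<close> times the squared radius by an upper bound.\<close>
  define e where "e = (\<lambda>n::nat. 2 / sqrt (\<delta>1 * real n powr \<beta>) +
      sqrt (exp (2 * c / \<kappa> * real n powr (- (2 * \<beta>))) - 1) + \<epsilon> n)"
  have \<epsilon>0: "\<epsilon> \<longlonglongrightarrow> 0"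
    unfolding \<epsilon>_def using \<beta> by (intro tendsto_neg_powr filterlim_real_sequentially) auto
  have "e \<longlonglongrightarrow> 0 + sqrt (exp (2 * c / \<kappa> * 0) - 1) + 0"
    unfolding e_def
  proof (intro tendsto_add tendsto_real_sqrt tendsto_diff tendsto_exp tendsto_mult tendsto_const \<epsilon>0)
    show "(\<lambda>n. real n powr (- (2 * \<beta>))) \<longlonglongrightarrow> 0"
      using \<beta> by (intro tendsto_neg_powr filterlim_real_sequentially) auto
    have "filterlim (\<lambda>n. sqrt (\<delta>1 * real n powr \<beta>)) at_top sequentially"
      using assms(9) \<beta>
      by (intro filterlim_compose[OF sqrt_at_top] filterlim_tendsto_pos_mult_at_top[OF tendsto_const]
        filterlim_compose[OF filterlim_powr_at_top] filterlim_real_sequentially) auto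
    then show "(\<lambda>n. 2 / sqrt (\<delta>1 * real n powr \<beta>)) \<longlonglongrightarrow> 0"
      by (intro tendsto_divide_0[OF tendsto_const] filterlim_at_top_imp_at_infinity)
  qed
  then have e0: "e \<longlonglongrightarrow> 0" by simp
  have ev1: "eventually (\<lambda>n. \<epsilon> n < r) sequentially"
    using order_tendstoD(2)[OF \<epsilon>0 r(1)] .
  \<comment> \<open>The exchange bound concerns an observed time. For fixed \<open>k\<close> this
    holds once \<open>n\<close> is large, as the exponent \<open>2 - \<alpha>\<close> is
    positive.\<close>
  have ev2: "eventually (\<lambda>n. k \<le> m n) sequentially"
  proof -
    have "filterlim (\<lambda>n. c * real n powr (2 - \<alpha>)) at_top sequentially"
      using assms(3,5)
      by (intro filterlim_tendsto_pos_mult_at_top[OF tendsto_const]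
        filterlim_compose[OF filterlim_powr_at_top] filterlim_real_sequentially) auto
    then have "eventually (\<lambda>n. real k \<le> c * real n powr (2 - \<alpha>)) sequentially"
      unfolding filterlim_at_top by blast
    then show ?thesis
      by eventually_elim (simp add: m le_nat_floor)
  qed
  have "eventually (\<lambda>n. norm (conditional_mutual_information b (count_space {0, 1}) (observation_space (m n) n)
      (Pi\<^sub>M {1..n} (\<lambda>_. borel)) (X 1 k) (observation X Perm (m n) n) (\<lambda>\<omega>. \<lambda>u\<in>{1..n}. p u \<omega>)) \<le>
      e n * (4 / (\<kappa> * ln b))) sequentially"
    using ev1 ev2 eventually_ge_at_top[of 2]
  proof eventually_elim
    case (elim n)
    have n: "real n > 0" using elim by simp
    have \<epsilon>n: "0 < \<epsilon> n" using n by (simp add: \<epsilon>_def)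
    have near_bounds: "r \<le> q \<and> r \<le> 1 - q" if "\<bar>q - p1\<bar> \<le> \<epsilon> n" for q
      using that elim(1) r by (auto simp: abs_le_iff)
    have near_var: "\<kappa> \<le> q * (1 - q)" if "\<bar>q - p1\<bar> \<le> \<epsilon> n" for q
      unfolding \<kappa>_def using near_bounds[OF that] r(1) by (intro mult_mono) auto
    define q where "q = expectation (\<lambda>\<omega>. near (\<epsilon> n) (p 2 \<omega>))"
    have q_eq: "expectation (\<lambda>\<omega>. near (\<epsilon> n) (p u \<omega>)) = q" if "u \<ge> 2" for u
      unfolding q_def expectation_near[OF that] expectation_near[OF order_refl] ..
    have q_ge: "2 * \<delta>1 * \<epsilon> n \<le> q"
      unfolding q_def
    proof (rule expectation_near_ge)
      show "{p1 - \<epsilon> n..p1 + \<epsilon> n} \<subseteq> {0<..<1}" using elim(1) r by auto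
      show "\<delta>1 \<le> f x" if "x \<in> {0<..<1}" for x using assms(11)[OF that] by simp
    qed (use \<epsilon>n assms(9) in auto)
    have q0: "0 < q" using q_ge \<epsilon>n assms(9) by (intro less_le_trans[OF _ q_ge]) simp
    have L: "\<delta>1 * real n powr \<beta> \<le> real (n - 1) * q"
    proof -
      have "real n powr \<beta> = real n * \<epsilon> n"
        using n powr_mult_base[of "real n" "\<beta> - 1"] by (simp add: \<epsilon>_def)
      \<comment> \<open>The interval around \<open>p1\<close> has length
        \<open>2 * \<epsilon> n\<close>; this factor 2 pays for replacing \<open>n - 1\<close> by
        \<open>n / 2\<close>, which is smaller or equal from \<open>n = 2\<close> on.\<close>
      then have "\<delta>1 * real n powr \<beta> = (real n / 2) * (2 * \<delta>1 * \<epsilon> n)" by simp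
      also have "\<dots> \<le> real (n - 1) * q"
        using elim(3) q_ge \<epsilon>n assms(9) by (intro mult_mono) auto
      finally show ?thesis .
    qed
    have mn: "real (m n) * (\<epsilon> n)\<^sup>2 \<le> c * real n powr (- (2 * \<beta>))"
    proof -
      have "real (m n) \<le> c * real n powr (2 - \<alpha>)"
        unfolding m using assms(3) by (intro of_nat_floor) simp
      then have "real (m n) * (\<epsilon> n)\<^sup>2 \<le> c * real n powr (2 - \<alpha>) * (\<epsilon> n)\<^sup>2"
        by (intro mult_right_mono) auto
      also have "\<dots> = c * real n powr (- (2 * \<beta>))"
      proof -
        \<comment> \<open>Since \<alpha> = 4 \<beta>, the exponents 2 - \<alpha> and 2 \<beta> - 2
          add up to -2 \<beta>.\<close>
        have "(\<epsilon> n)\<^sup>2 = real n powr (2 * \<beta> - 2)"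
          using n by (simp add: \<epsilon>_def power2_eq_square flip: powr_add)
        then show ?thesis using n by (simp add: \<beta>_def mult.assoc flip: powr_add)
      qed
      finally show ?thesis .
    qed
    define \<eta> where "\<eta> = 2 / sqrt (real (n - 1) * q) + sqrt (exp (2 * real (m n) * (\<epsilon> n)\<^sup>2 / \<kappa>) - 1) + \<epsilon> n"
    have \<eta>: "\<eta> \<le> e n"
      unfolding \<eta>_def e_def
    proof (intro add_mono order_refl)
      show "2 / sqrt (real (n - 1) * q) \<le> 2 / sqrt (\<delta>1 * real n powr \<beta>)"
      proof (intro divide_left_mono mult_pos_pos real_sqrt_le_mono L)
        have "0 < \<delta>1 * real n powr \<beta>" using n assms(9) by simp
        with less_le_trans[OF this L] show "0 < sqrt (real (n - 1) * q)" "0 < sqrt (\<delta>1 * real n powr \<beta>)"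
          unfolding real_sqrt_gt_0_iff by this
      qed simp
      have "2 * real (m n) * (\<epsilon> n)\<^sup>2 / \<kappa> \<le> 2 * (c * real n powr (- (2 * \<beta>))) / \<kappa>"
        using mn \<kappa>(1) by (intro divide_right_mono) auto
      then show "sqrt (exp (2 * real (m n) * (\<epsilon> n)\<^sup>2 / \<kappa>) - 1) \<le>
          sqrt (exp (2 * c / \<kappa> * real n powr (- (2 * \<beta>))) - 1)"
        by (intro real_sqrt_le_mono diff_right_mono) simp
    qed
    have "\<bar>conditional_mutual_information b (count_space {0, 1}) (observation_space (m n) n)
      (Pi\<^sub>M {1..n} (\<lambda>_. borel)) (X 1 k) (observation X Perm (m n) n) (p_upto n)\<bar> \<le> 4 * \<eta> / (\<kappa> * ln b)"
    proof (rule conditional_mutual_information_bounds[OF assms(2) k \<kappa>])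
      fix A :: "((nat \<times> nat \<Rightarrow> nat) \<times> (nat \<Rightarrow> real)) set"
      assume A: "A \<in> sets (observation_space (m n) n \<Otimes>\<^sub>M Pi\<^sub>M {1..n} (\<lambda>_. borel))"
      show "\<bar>expectation (\<lambda>\<omega>. (real (X 1 k \<omega>) - p1) * indicator A (observation X Perm (m n) n \<omega>, p_upto n \<omega>))\<bar> \<le> \<eta>"
        unfolding \<eta>_def
      proof (rule deviation_le[OF elim(3) _ A _ \<kappa>(1) near_var less_imp_le[OF \<epsilon>n] q0 q_eq])
        show "k \<in> {1..m n}" using k elim(2) by simp
        show "AE \<omega> in M. 0 < p v \<omega> \<and> p v \<omega> < 1" if "v \<ge> 1" for v
          using assms(7) by (intro AE_p_in_unit_interval[OF _ _ assms(12) that]) auto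
      qed
    qed
    also have "4 * \<eta> / (\<kappa> * ln b) \<le> 4 * e n / (\<kappa> * ln b)"
      using \<eta> \<kappa>(1) assms(2) by (intro divide_right_mono) auto
    finally show ?case by (simp add: p_upto_def[abs_def] mult.commute)
  qed
  moreover have "(\<lambda>n. e n * (4 / (\<kappa> * ln b))) \<longlonglongrightarrow> 0"
    using tendsto_mult_left_zero[OF e0] .
  ultimately show "(\<lambda>n. conditional_mutual_information b (count_space {0, 1}) (observation_space (m n) n)
      (Pi\<^sub>M {1..n} (\<lambda>_. borel)) (X 1 k) (observation X Perm (m n) n) (\<lambda>\<omega>. \<lambda>u\<in>{1..n}. p u \<omega>)) \<longlonglongrightarrow> 0"
    by (rule Lim_null_comparison)
qed

end
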